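(* Let $p$ be a prime, $n\ge1$, $D=p^n$, and let $|S\rangle$ be a pure stabilizer state of $N$ qudits of dimension $D$ whose qudits are partitioned into $m$ subsystems (parties) $\alpha=1,\dots,m$. Let $g^{(1)},\dots,g^{(\mathcal N)}$ be a generating set of $S$ with corresponding subsystem phase matrices $M_1,\dots,M_m\in\mathbb{Z}_{p^n}^{\mathcal N\times\mathcal N}$. Suppose there exist a set $\mathfrak B\subseteq\{1,\dots,m\}$ of subsystems, an integer $n'$ with $1\le n'\le n$, and $\vec v\in\mathbb{Z}_{p^n}^{\mathcal N}$ with $\vec v\not\equiv\vec 0\pmod p$ such that \[ p^{n-n'}\vec v\in\bigcap_{\beta\in\mathfrak B}\operatorname{span}(M_\beta)\quad\text{and}\quad p^{n-1}\vec v\notin\operatorname{span}\Big(\sum_{\beta\in\mathfrak B}M_\beta\Big). \] Then, adjoining to each party $\beta\in\mathfrak B$ one ancilla qudit of dimension $p^{n'}$ in state $|0\rangle$, there exist unitaries $U_\beta$ ($\beta\in\mathfrak B$), each acting only on the qudits of subsystem $\beta$ together with its ancilla, such that \[ \Big(\bigotimes_{\beta\in\mathfrak B}U_\beta\Big)\big(|S\rangle\otimes|0\rangle_{p^{n'},\mathfrak B}\big)=|\tilde S\rangle\otimes|GHZ\rangle_{p,\mathfrak B}^{\otimes n'} \] for some state $|\tilde S\rangle$, where $|GHZ\rangle_{p,\mathfrak B}=p^{-1/2}\sum_{k=0}^{p-1}\bigotimes_{\beta\in\mathfrak B}|k\rangle_\beta$ is a $|\mathfrak B|$-partite GHZ state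 of $p$-level qudits, one held by each party in $\mathfrak B$ (an EPR pair when $|\mathfrak B|=2$).
   Context: Let $\omega=e^{2\pi i/D}$. On $\mathbb{C}^D$ let $X=\sum_j|j+1\rangle\langle j|$, $Z=\sum_j\omega^j|j\rangle\langle j|$ (indices mod $D$). The $N$-qudit Pauli group consists of operators $\omega^\gamma\prod_i X_i^{x_i}Z_i^{z_i}$ with $x_i,z_i\in\mathbb{Z}_D$, $\gamma$ an integer (integer or half-integer if $D$ even). A stabilizer group is an abelian subgroup $S$ of the Pauli group whose only element proportional to the identity is the identity; if $|S|=D^N$ it stabilizes a unique state $|S\rangle$ ($|S\rangle\langle S|=D^{-N}\sum_{s\in S}s$), a pure stabilizer state. For a Pauli operator $g$ and subsystem $\alpha$, $g_\alpha$ denotes its tensor factor on the qudits of $\alpha$. Subsystem phase matrices: given generators $g^{(1)},\dots,g^{(\mathcal N)}$ of $S$, $M_\alpha\in\mathbb{Z}_D^{\mathcal N\times\mathcal N}$ is defined by $g^{(j)}_\alpha g^{(i)}_\alpha=\omega^{M_{\alpha,ij}}g^{(i)}_\alpha g^{(j)}_\alpha$; equivalently, if $g^{(i)}\propto\prod_k X_k^{x^{(i)}_k}Z_k^{z^{(i)}_k}$, then $M_{\alpha,ij}=\sum_{k\in\alpha}(x^{(i)}_kz^{(j)}_k-z^{(i)}_kx^{(j)}_k)$. For a matrix $M$ over $\mathbb{Z}_{p^n}$, $\operatorname{span}(M)=\{M\vec u:\vec u\in\mathbb{Z}_{p^n}^{\mathcal N}\}$ (its column span as a $\mathbb{Z}_{p^n}$-module).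 *)

theory Defs
  imports Complex_Main "HOL-Library.FuncSet" "HOL-Computational_Algebra.Primes"
begin

text \<open>Computational basis configurations of N qudits of dimension D:
  a basis state |j_0 ... j_{N-1}> is an extensional function on {..<N}.\<close>

type_synonym cfg = "nat \<Rightarrow> nat"
type_synonym qop = "cfg \<Rightarrow> cfg \<Rightarrow> complex"

definition cfgs :: "nat \<Rightarrow> nat \<Rightarrow> cfg set" where
  "cfgs N D = PiE {..<N} (\<lambda>_. {..<D})"

definition restr_op :: "nat \<Rightarrow> nat \<Rightarrow> qop \<Rightarrow> qop" where
  "restr_op N D A = (\<lambda>j k. if j \<in> cfgs N D \<and> k \<in> cfgs N D then A j k else 0)"

definition op_id :: "nat \<Rightarrow> nat \<Rightarrow> qop" where
  "op_id N D = restr_op N D (\<lambda>j k. if j = k then 1 else 0)"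

definition op_mul :: "nat \<Rightarrow> nat \<Rightarrow> qop \<Rightarrow> qop \<Rightarrow> qop" where
  "op_mul N D A B = restr_op N D (\<lambda>j k. \<Sum>l\<in>cfgs N D. A j l * B l k)"

text \<open>Pauli operator  omega^(gamma/2) * prod_i X_i^(x_i) Z_i^(z_i), omega = exp(2 pi i/D).
  The phase exponent is gamma/2 with gamma an integer, so that half-integer phases
  (allowed when D is even) are represented; X|k> = |k+1>, Z|k> = omega^k |k>.\<close>

definition pauli :: "nat \<Rightarrow> nat \<Rightarrow> int \<Rightarrow> (nat \<Rightarrow> int) \<Rightarrow> (nat \<Rightarrow> int) \<Rightarrow> qop" where
  "pauli N D \<gamma> x z = restr_op N D (\<lambda>j k.
     if (\<forall>i<N. int (j i) = (int (k i) + x i) mod int D)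
     then cis (pi * of_int \<gamma> / real D) * cis (2 * pi * of_int (\<Sum>i<N. z i * int (k i)) / real D)
     else 0)"

definition pauli_phase_ok :: "nat \<Rightarrow> int \<Rightarrow> bool" where
  "pauli_phase_ok D \<gamma> \<longleftrightarrow> even \<gamma> \<or> even D"

text \<open>Group generated by a finite set of (finite-order) Pauli operators.\<close>

inductive_set gen_group :: "nat \<Rightarrow> nat \<Rightarrow> qop set \<Rightarrow> qop set" for N D G where
  gen_id: "op_id N D \<in> gen_group N D G"
| gen_mul: "g \<in> G \<Longrightarrow> s \<in> gen_group N D G \<Longrightarrow> op_mul N D g s \<in> gen_group N D G"

definition stabilizer_group :: "nat \<Rightarrow> nat \<Rightarrow> qop set \<Rightarrow> bool" where
  "stabilizer_group N D S \<longleftrightarrow>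
     (\<forall>a\<in>S. \<forall>b\<in>S. op_mul N D a b = op_mul N D b a) \<and>
     (\<forall>s\<in>S. \<forall>c::complex. s = (\<lambda>j k. c * op_id N D j k) \<longrightarrow> s = op_id N D)"

definition is_stabilizer_state :: "nat \<Rightarrow> nat \<Rightarrow> qop set \<Rightarrow> (cfg \<Rightarrow> complex) \<Rightarrow> bool" where
  "is_stabilizer_state N D S \<psi> \<longleftrightarrow>
     (\<forall>j\<in>cfgs N D. \<forall>k\<in>cfgs N D. \<psi> j * cnj (\<psi> k) = (\<Sum>s\<in>S. s j k) / of_nat (D ^ N))"

definition phase_mat :: "nat \<Rightarrow> (nat \<Rightarrow> nat \<Rightarrow> int) \<Rightarrow> (nat \<Rightarrow> nat \<Rightarrow> int) \<Rightarrow> nat set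
    \<Rightarrow> nat \<Rightarrow> nat \<Rightarrow> int" where
  "phase_mat D gx gz \<alpha> i j = (\<Sum>k\<in>\<alpha>. gx i k * gz j k - gz i k * gx j k) mod int D"

definition in_span :: "nat \<Rightarrow> nat \<Rightarrow> (nat \<Rightarrow> nat \<Rightarrow> int) \<Rightarrow> (nat \<Rightarrow> int) \<Rightarrow> bool" where
  "in_span D K M w \<longleftrightarrow>
     (\<exists>u::nat \<Rightarrow> int. \<forall>i<K. w i mod int D = (\<Sum>j<K. M i j * u j) mod int D)"

definition party :: "nat \<Rightarrow> (nat \<Rightarrow> nat) \<Rightarrow> nat \<Rightarrow> nat set" where
  "party N part \<beta> = {i. i < N \<and> part i = \<beta>}"

text \<open>Local basis of party beta: its qudits together with its ancilla of dimension q.\<close>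

definition local_cfgs :: "nat \<Rightarrow> nat \<Rightarrow> (nat \<Rightarrow> nat) \<Rightarrow> nat \<Rightarrow> nat \<Rightarrow> (cfg \<times> nat) set" where
  "local_cfgs N D part q \<beta> = PiE (party N part \<beta>) (\<lambda>_. {..<D}) \<times> {..<q}"

definition unitary_on :: "'b set \<Rightarrow> ('b \<Rightarrow> 'b \<Rightarrow> complex) \<Rightarrow> bool" where
  "unitary_on L U \<longleftrightarrow>
     (\<forall>x\<in>L. \<forall>y\<in>L. (\<Sum>z\<in>L. U x z * cnj (U y z)) = (if x = y then 1 else 0)) \<and>
     (\<forall>x\<in>L. \<forall>y\<in>L. (\<Sum>z\<in>L. cnj (U z x) * U z y) = (if x = y then 1 else 0))"

text \<open>Full basis after adjoining one ancilla of dimension q to each party in B: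
  pairs (qudit configuration, ancilla configuration).\<close>

definition full_cfgs :: "nat \<Rightarrow> nat \<Rightarrow> nat set \<Rightarrow> nat \<Rightarrow> (cfg \<times> cfg) set" where
  "full_cfgs N D B q = cfgs N D \<times> PiE B (\<lambda>_. {..<q})"

definition local_tensor :: "nat \<Rightarrow> (nat \<Rightarrow> nat) \<Rightarrow> nat set
    \<Rightarrow> (nat \<Rightarrow> (cfg \<times> nat) \<Rightarrow> (cfg \<times> nat) \<Rightarrow> complex)
    \<Rightarrow> (cfg \<times> cfg) \<Rightarrow> (cfg \<times> cfg) \<Rightarrow> complex" where
  "local_tensor N part B U = (\<lambda>(j, a) (k, b).
     (\<Prod>\<beta>\<in>B. U \<beta> (restrict j (party N part \<beta>), a \<beta>) (restrict k (party N part \<beta>), b \<beta>)) *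
     (if \<forall>i<N. part i \<notin> B \<longrightarrow> j i = k i then 1 else 0))"

definition with_ancillas :: "nat set \<Rightarrow> (cfg \<Rightarrow> complex) \<Rightarrow> (cfg \<times> cfg) \<Rightarrow> complex" where
  "with_ancillas B \<psi> = (\<lambda>(k, b). \<psi> k * (if b = restrict (\<lambda>_. 0) B then 1 else 0))"

definition ghz :: "nat \<Rightarrow> nat set \<Rightarrow> (nat \<Rightarrow> nat) \<Rightarrow> complex" where
  "ghz p B c = (if \<exists>t<p. \<forall>\<beta>\<in>B. c \<beta> = t then complex_of_real (1 / sqrt (real p)) else 0)"

text \<open>GHZ^(tensor n'): the ancilla of dimension p^n' of each party is identified with n'
  p-level qudits via base-p digits; the r-th copy of GHZ lives on the r-th digits.\<close>

definition ghz_pow :: "nat \<Rightarrow> nat \<Rightarrow> nat set \<Rightarrow> cfg \<Rightarrow> complex" where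
  "ghz_pow p n' B a = (\<Prod>r<n'. ghz p B (\<lambda>\<beta>. a \<beta> div p ^ r mod p))"

end

theory Submission
  imports Defs "HOL-Number_Theory.Cong"
begin

text \<open>
  Put \<open>q = p\<^sup>n\<^sup>'\<close> and \<open>\<zeta> = e\<^bsup>2\<pi>i/q\<^esup>\<close>. A solution \<open>u\<^sub>\<beta>\<close> of \<open>M\<^sub>\<beta> u\<^sub>\<beta> = p\<^bsup>n-n'\<^esup> v\<close> gives a Pauli
  operator \<open>T\<^sub>\<beta>\<close> of party \<open>\<beta>\<close>, the corresponding product of the restricted generators, that
  commutes with the \<open>i\<close>-th generator up to \<open>\<zeta>\<^bsup>v\<^sub>i\<^esup>\<close>. Since this phase does not depend on \<open>\<beta>\<close>,
  the operators \<open>T\<^sub>\<beta> T\<^sub>\<beta>\<^sub>'\<^sup>-\<^sup>1\<close> and \<open>T\<^sub>\<beta>\<^sup>q\<close> commute with the stabilizer group, so \<open>\<psi>\<close> is an eigenvector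
  of each of them. The second span condition yields, by duality over \<open>\<int>\<^sub>D\<close>, a vector \<open>w\<close> in the left
  kernel of \<open>\<Sum>\<^sub>\<beta> M\<^sub>\<beta>\<close> with \<open>w\<cdot>v\<close> a unit; the product of the generators with exponents \<open>w\<close>
  (normalised so that \<open>w\<cdot>v = -1\<close>), restricted to the parties in \<open>B\<close>, is a tensor product
  of local Paulis \<open>H\<^sub>\<beta>\<close> that has \<open>\<psi>\<close> as an eigenvector and satisfies
  \<open>H\<^sub>\<beta> T\<^sub>\<beta> = \<zeta> T\<^sub>\<beta> H\<^sub>\<beta>\<close>. After rescaling, \<open>T\<^sub>\<beta>\<close> and \<open>H\<^sub>\<beta>\<close> act on \<open>\<psi>\<close> like the clock and
  shift operators on a GHZ state of dimension \<open>q\<close>: each party copies the eigenvalue of \<open>T\<^sub>\<beta>\<close> into its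
  ancilla by phase estimation and then applies the power of \<open>H\<^sub>\<beta>\<close> given by the ancilla, which
  disentangles the ancillas from the rest. A GHZ state of dimension \<open>p\<^sup>n\<^sup>'\<close> is \<open>n'\<close> copies of one of
  dimension \<open>p\<close> by base-\<open>p\<close> digits.
\<close>

subsection \<open>Characters of \<open>\<int>\<^sub>D\<close>\<close>

definition ph :: "nat \<Rightarrow> int \<Rightarrow> complex" where
  "ph D e = cis (pi * of_int e / real D)"

lemma ph_0 [simp]: "ph D 0 = 1"
  by (simp add: ph_def)

lemma ph_add: "ph D (a + b) = ph D a * ph D b"
  by (simp add: ph_def cis_mult algebra_simps add_divide_distrib)

lemma norm_ph [simp]: "norm (ph D e) = 1"
  by (simp add: ph_def)

lemma cnj_ph: "cnj (ph D e) = ph D (- e)"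
  by (simp add: ph_def cis_cnj)

lemma ph_minus_mult [simp]: "ph D (- e) * ph D e = 1" "ph D e * ph D (- e) = 1"
  by (simp_all flip: ph_add)

lemma ph_power: "ph D e ^ k = ph D (int k * e)"
  unfolding ph_def by (simp add: DeMoivre algebra_simps)

lemma ph_sum: "ph D (\<Sum>i\<in>A. f i) = (\<Prod>i\<in>A. ph D (f i))"
  by (induction A rule: infinite_finite_induct) (simp_all add: ph_add)

lemma ph_eq_1_iff:
  assumes "D > 0"
  shows "ph D e = 1 \<longleftrightarrow> 2 * int D dvd e"
proof
  assume "ph D e = 1"
  hence "cos (pi * of_int e / real D) = 1"
    by (simp add: ph_def complex_eq_iff)
  then obtain m :: int where "pi * of_int e / real D = of_int m * 2 * pi"
    unfolding cos_one_2pi_int by blast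
  hence "of_int e = (of_int (m * 2 * int D) :: real)"
    using assms by (simp add: field_simps)
  hence "e = m * 2 * int D" by (simp only: of_int_eq_iff)
  thus "2 * int D dvd e" by simp
next
  assume "2 * int D dvd e"
  then obtain m where "e = 2 * int D * m" ..
  thus "ph D e = 1"
    using assms cis_multiple_2pi[of "of_int m"] by (simp add: ph_def field_simps)
qed

lemma ph_cong:
  assumes "D > 0" "[a = b] (mod 2 * int D)"
  shows "ph D a = ph D b"
proof -
  have "ph D (a - b) = 1"
    using assms by (simp add: ph_eq_1_iff cong_iff_dvd_diff)
  thus ?thesis using ph_add[of D "a - b" b] by simp
qed

lemma ph_double_cong:
  assumes "D > 0" "[a = b] (mod int D)"
  shows "ph D (2 * a) = ph D (2 * b)"
proof (rule ph_cong[OF assms(1)])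
  have "2 * int D dvd 2 * (a - b)"
    using assms(2) by (simp only: cong_iff_dvd_diff mult_dvd_mono dvd_refl)
  thus "[2 * a = 2 * b] (mod 2 * int D)" by (simp add: cong_iff_dvd_diff)
qed

lemma ph_rescale: "c > 0 \<Longrightarrow> ph (q * c) (int c * e) = ph q e"
  by (simp add: ph_def)

lemma root_sum:
  assumes "q > 0"
  shows "(\<Sum>s<q. ph q (2 * (int s * d))) = (if int q dvd d then of_nat q else 0)"
proof -
  let ?r = "ph q (2 * d)"
  have pow: "ph q (2 * (int s * d)) = ?r ^ s" for s
    by (simp add: ph_power algebra_simps)
  have r1: "?r = 1 \<longleftrightarrow> int q dvd d"
    using assms by (simp add: ph_eq_1_iff)
  have "?r ^ q = 1"
    using assms by (simp add: ph_power ph_eq_1_iff)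
  thus ?thesis
    using r1 by (auto simp: pow sum_gp_strict)
qed

text \<open>Poisson summation: averaging \<open>\<omega>\<^bsup>w\<cdot>(M u - y)\<^esup>\<close> over all \<open>u\<close> and \<open>w\<close> shows
  that the number of solutions of \<open>M u = y\<close> is the sum of \<open>\<omega>\<^bsup>-w\<cdot>y\<^esup>\<close> over the left kernel.\<close>

lemma separating_functional:
  fixes M :: "nat \<Rightarrow> nat \<Rightarrow> int"
  assumes D: "D > 0" and nspan: "\<not> in_span D K M y"
  shows "\<exists>w :: nat \<Rightarrow> int. (\<forall>j<K. int D dvd (\<Sum>i<K. w i * M i j)) \<and> \<not> int D dvd (\<Sum>i<K. w i * y i)"
proof (rule ccontr)
  assume contra: "\<not> ?thesis"
  have ker: "int D dvd (\<Sum>i<K. w i * y i)"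
    if "\<forall>j<K. int D dvd (\<Sum>i<K. w i * M i j)" for w
    using contra that by blast
  define P where "P = PiE {..<K} (\<lambda>_. {..<D})"
  have finP: "finite P" by (simp add: P_def finite_PiE)
  define e where "e w u = (\<Sum>i<K. int (w i) * ((\<Sum>j<K. M i j * int (u j)) - y i))"
    for w u :: "nat \<Rightarrow> nat"
  have prod_root: "(\<Sum>u\<in>P. ph D (2 * (\<Sum>j<K. int (u j) * c j)))
      = (\<Prod>j<K. if int D dvd c j then of_nat D else 0)" for c :: "nat \<Rightarrow> int"
  proof -
    have "(\<Sum>u\<in>P. ph D (2 * (\<Sum>j<K. int (u j) * c j)))
        = (\<Sum>u\<in>P. \<Prod>j<K. ph D (2 * (int (u j) * c j)))"
      by (simp add: sum_distrib_left ph_sum)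
    also have "\<dots> = (\<Prod>j<K. \<Sum>s<D. ph D (2 * (int s * c j)))"
      unfolding P_def by (rule prod_sum_PiE[symmetric]) auto
    finally show ?thesis by (simp add: root_sum D)
  qed
  have "(\<Sum>w\<in>P. ph D (2 * e w u)) = 0" for u
  proof -
    obtain i where "i < K" "\<not> int D dvd (\<Sum>j<K. M i j * int (u j)) - y i"
      using nspan unfolding in_span_def mod_eq_dvd_iff
      by (auto simp: dvd_diff_commute[of _ "y _"] dest!: spec[of _ "\<lambda>j. int (u j)"])
    thus ?thesis unfolding e_def by (subst prod_root) auto
  qed
  hence "0 = (\<Sum>u\<in>P. \<Sum>w\<in>P. ph D (2 * e w u))" by simp
  also have "\<dots> = (\<Sum>w\<in>P. \<Sum>u\<in>P. ph D (2 * e w u))" by (rule sum.swap)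
  also have "\<dots> = (\<Sum>w\<in>P. if \<forall>j<K. int D dvd (\<Sum>i<K. int (w i) * M i j) then of_nat D ^ K else 0)"
  proof (intro sum.cong refl)
    fix w assume "w \<in> P"
    have split: "2 * e w u = 2 * - (\<Sum>i<K. int (w i) * y i) +
        2 * (\<Sum>j<K. int (u j) * (\<Sum>i<K. int (w i) * M i j))" for u
    proof -
      have "(\<Sum>i<K. \<Sum>j<K. int (w i) * (M i j * int (u j)))
          = (\<Sum>j<K. \<Sum>i<K. int (u j) * (int (w i) * M i j))"
        by (subst sum.swap) (simp add: algebra_simps)
      hence "e w u = - (\<Sum>i<K. int (w i) * y i) + (\<Sum>j<K. int (u j) * (\<Sum>i<K. int (w i) * M i j))"
        by (simp add: e_def right_diff_distrib sum_subtractf sum_distrib_left)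
      thus ?thesis by simp
    qed
    have "(\<Sum>u\<in>P. ph D (2 * e w u)) =
        ph D (2 * - (\<Sum>i<K. int (w i) * y i)) *
        (\<Sum>u\<in>P. ph D (2 * (\<Sum>j<K. int (u j) * (\<Sum>i<K. int (w i) * M i j))))"
      unfolding split ph_add by (rule sum_distrib_left[symmetric])
    moreover have "ph D (2 * - (\<Sum>i<K. int (w i) * y i)) = 1"
      if "\<forall>j<K. int D dvd (\<Sum>i<K. int (w i) * M i j)"
      using ker[of "\<lambda>i. int (w i)"] that D by (simp add: ph_eq_1_iff)
    ultimately show "(\<Sum>u\<in>P. ph D (2 * e w u)) =
        (if \<forall>j<K. int D dvd (\<Sum>i<K. int (w i) * M i j) then of_nat D ^ K else 0)"
      by (auto simp: prod_root)
  qed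
  also have "\<dots> = of_nat (card {w\<in>P. \<forall>j<K. int D dvd (\<Sum>i<K. int (w i) * M i j)}) * of_nat D ^ K"
    by (subst sum.inter_filter[OF finP, symmetric]) simp
  finally have "card {w\<in>P. \<forall>j<K. int D dvd (\<Sum>i<K. int (w i) * M i j)} = 0"
    using D by simp
  hence "{w\<in>P. \<forall>j<K. int D dvd (\<Sum>i<K. int (w i) * M i j)} = {}"
    using finP by simp
  moreover have "(\<lambda>i\<in>{..<K}. 0) \<in> {w\<in>P. \<forall>j<K. int D dvd (\<Sum>i<K. int (w i) * M i j)}"
    using D by (auto simp: P_def)
  ultimately show False by blast
qed

subsection \<open>Weyl operators\<close>

text \<open>\<open>weyl \<alpha> D x z\<close> is the Pauli operator \<open>\<tau>\<^bsup>x\<cdot>z\<^esup> X\<^sup>x Z\<^sup>z\<close> on the qudits in \<open>\<alpha>\<close>, with integer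
  labels and \<open>\<tau> = e\<^bsup>\<pi>i/D\<^esup>\<close>. With this symmetric phase, operators whose labels have
  symplectic product zero multiply by adding the labels; in particular powers multiply the label.\<close>

definition shift :: "nat set \<Rightarrow> nat \<Rightarrow> (nat \<Rightarrow> int) \<Rightarrow> cfg \<Rightarrow> cfg" where
  "shift \<alpha> D x j = (\<lambda>i\<in>\<alpha>. nat ((int (j i) - x i) mod int D))"

definition wphase :: "nat set \<Rightarrow> nat \<Rightarrow> (nat \<Rightarrow> int) \<Rightarrow> (nat \<Rightarrow> int) \<Rightarrow> cfg \<Rightarrow> complex" where
  "wphase \<alpha> D x z j = ph D (\<Sum>i\<in>\<alpha>. z i * (2 * int (j i) - x i))"

definition wmat where
  "wmat \<alpha> D x z j k = (if k = shift \<alpha> D x j then wphase \<alpha> D x z j else 0)"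

definition weyl :: "nat set \<Rightarrow> nat \<Rightarrow> (nat \<Rightarrow> int) \<Rightarrow> (nat \<Rightarrow> int) \<Rightarrow> (cfg \<Rightarrow> complex) \<Rightarrow> cfg \<Rightarrow> complex" where
  "weyl \<alpha> D x z f j = wphase \<alpha> D x z j * f (shift \<alpha> D x j)"

lemma norm_wphase [simp]: "norm (wphase \<alpha> D x z j) = 1"
  by (simp add: wphase_def)

lemma shift_in [simp]: "D > 0 \<Longrightarrow> shift \<alpha> D x j \<in> PiE \<alpha> (\<lambda>_. {..<D})"
  by (auto simp: shift_def nat_less_iff)

lemma int_shift: "D > 0 \<Longrightarrow> i \<in> \<alpha> \<Longrightarrow> int (shift \<alpha> D x j i) = (int (j i) - x i) mod int D"
  by (simp add: shift_def)

lemma shift_shift: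
  "D > 0 \<Longrightarrow> shift \<alpha> D y (shift \<alpha> D x j) = shift \<alpha> D (\<lambda>i. x i + y i) j"
  by (auto simp: shift_def fun_eq_iff restrict_def mod_diff_left_eq algebra_simps)

lemma shift_0:
  assumes "j \<in> PiE \<alpha> (\<lambda>_. {..<D})"
  shows "shift \<alpha> D (\<lambda>_. 0) j = j"
  using assms by (auto simp: shift_def fun_eq_iff restrict_def PiE_def extensional_def Pi_def)

lemma bij_betw_shift:
  assumes "D > 0"
  shows "bij_betw (shift \<alpha> D x) (PiE \<alpha> (\<lambda>_. {..<D})) (PiE \<alpha> (\<lambda>_. {..<D}))"
  by (rule bij_betw_byWitness[where f' = "shift \<alpha> D (\<lambda>i. - x i)"])
     (simp_all add: assms shift_shift shift_0 image_subset_iff)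

lemma wphase_shift:
  assumes "D > 0"
  shows "wphase \<alpha> D x' z' (shift \<alpha> D x j) = ph D (\<Sum>i\<in>\<alpha>. z' i * (2 * (int (j i) - x i) - x' i))"
  unfolding wphase_def
proof (intro ph_cong cong_sum assms)
  fix i assume "i \<in> \<alpha>"
  have "2 * int D dvd 2 * (z' i * ((int (j i) - x i) mod int D - (int (j i) - x i)))"
    by (intro mult_dvd_mono dvd_mult) (auto simp: mod_eq_dvd_iff[symmetric])
  thus "[z' i * (2 * int (shift \<alpha> D x j i) - x' i) = z' i * (2 * (int (j i) - x i) - x' i)] (mod 2 * int D)"
    using \<open>i \<in> \<alpha>\<close> assms by (simp add: int_shift cong_iff_dvd_diff algebra_simps)
qed

lemma weyl_weyl:
  assumes "D > 0"
  shows "weyl \<alpha> D x z (weyl \<alpha> D x' z' f) j =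
    ph D (\<Sum>i\<in>\<alpha>. z i * x' i - x i * z' i) * weyl \<alpha> D (\<lambda>i. x i + x' i) (\<lambda>i. z i + z' i) f j"
proof -
  have "wphase \<alpha> D x z j * wphase \<alpha> D x' z' (shift \<alpha> D x j) =
      ph D (\<Sum>i\<in>\<alpha>. z i * x' i - x i * z' i) * wphase \<alpha> D (\<lambda>i. x i + x' i) (\<lambda>i. z i + z' i) j"
    unfolding wphase_shift[OF assms] unfolding wphase_def ph_add[symmetric] sum.distrib[symmetric]
    by (simp add: algebra_simps)
  thus ?thesis by (simp add: weyl_def shift_shift assms mult.assoc[symmetric])
qed

lemma weyl_commute:
  assumes "D > 0"
  shows "weyl \<alpha> D x z (weyl \<alpha> D x' z' f) j =
    ph D (2 * (\<Sum>i\<in>\<alpha>. z i * x' i - x i * z' i)) * weyl \<alpha> D x' z' (weyl \<alpha> D x z f) j"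
proof -
  have "ph D (\<Sum>i\<in>\<alpha>. z i * x' i - x i * z' i) =
      ph D (2 * (\<Sum>i\<in>\<alpha>. z i * x' i - x i * z' i)) * ph D (\<Sum>i\<in>\<alpha>. z' i * x i - x' i * z i)"
    by (simp add: sum_subtractf algebra_simps flip: ph_add)
  thus ?thesis by (simp add: weyl_weyl[OF assms] add.commute mult.assoc)
qed

subsection \<open>Unitaries\<close>

lemma sum_rotate:
  "(\<Sum>z\<in>A. \<Sum>u\<in>B. \<Sum>w\<in>C. f z u w) = (\<Sum>u\<in>B. \<Sum>w\<in>C. \<Sum>z\<in>A. f z u w)"
proof -
  have "(\<Sum>z\<in>A. \<Sum>u\<in>B. \<Sum>w\<in>C. f z u w) = (\<Sum>u\<in>B. \<Sum>z\<in>A. \<Sum>w\<in>C. f z u w)"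
    by (rule sum.swap)
  also have "\<dots> = (\<Sum>u\<in>B. \<Sum>w\<in>C. \<Sum>z\<in>A. f z u w)"
    by (intro sum.cong refl) (rule sum.swap)
  finally show ?thesis .
qed

lemma unitary_mult:
  assumes fin: "finite L" and U: "unitary_on L U" and V: "unitary_on L V"
  shows "unitary_on L (\<lambda>x y. \<Sum>w\<in>L. U x w * V w y)"
  unfolding unitary_on_def
proof (intro conjI ballI)
  fix x y assume xy: "x \<in> L" "y \<in> L"
  have "(\<Sum>z\<in>L. (\<Sum>w\<in>L. U x w * V w z) * cnj (\<Sum>w\<in>L. U y w * V w z))
      = (\<Sum>z\<in>L. \<Sum>w\<in>L. \<Sum>w'\<in>L. U x w * cnj (U y w') * (V w z * cnj (V w' z)))"
    unfolding cnj_sum sum_product by (simp add: algebra_simps)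
  also have "\<dots> = (\<Sum>w\<in>L. \<Sum>w'\<in>L. \<Sum>z\<in>L. U x w * cnj (U y w') * (V w z * cnj (V w' z)))"
    by (rule sum_rotate)
  also have "\<dots> = (\<Sum>w\<in>L. \<Sum>w'\<in>L. U x w * cnj (U y w') * (if w = w' then 1 else 0))"
    using V by (intro sum.cong refl) (simp add: unitary_on_def flip: sum_distrib_left)
  also have "\<dots> = (\<Sum>w\<in>L. U x w * cnj (U y w))"
    using fin by (simp add: if_distrib cong: if_cong)
  finally show "(\<Sum>z\<in>L. (\<Sum>w\<in>L. U x w * V w z) * cnj (\<Sum>w\<in>L. U y w * V w z)) = (if x = y then 1 else 0)"
    using U xy by (simp add: unitary_on_def)
next
  fix x y assume xy: "x \<in> L" "y \<in> L"
  have "(\<Sum>z\<in>L. cnj (\<Sum>w\<in>L. U z w * V w x) * (\<Sum>w\<in>L. U z w * V w y))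
      = (\<Sum>z\<in>L. \<Sum>w\<in>L. \<Sum>w'\<in>L. cnj (V w x) * V w' y * (cnj (U z w) * U z w'))"
    unfolding cnj_sum sum_product by (simp add: algebra_simps)
  also have "\<dots> = (\<Sum>w\<in>L. \<Sum>w'\<in>L. \<Sum>z\<in>L. cnj (V w x) * V w' y * (cnj (U z w) * U z w'))"
    by (rule sum_rotate)
  also have "\<dots> = (\<Sum>w\<in>L. \<Sum>w'\<in>L. cnj (V w x) * V w' y * (if w = w' then 1 else 0))"
    using U by (intro sum.cong refl) (simp add: unitary_on_def flip: sum_distrib_left)
  also have "\<dots> = (\<Sum>w\<in>L. cnj (V w x) * V w y)"
    using fin by (simp add: if_distrib cong: if_cong)
  finally show "(\<Sum>z\<in>L. cnj (\<Sum>w\<in>L. U z w * V w x) * (\<Sum>w\<in>L. U z w * V w y)) = (if x = y then 1 else 0)"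
    using V xy by (simp add: unitary_on_def)
qed

lemma unitary_monomial:
  assumes fin: "finite L" and bij: "bij_betw \<pi> L L" and unit: "\<And>x. x \<in> L \<Longrightarrow> norm (f x) = 1"
  shows "unitary_on L (\<lambda>x y. if y = \<pi> x then f x else 0)"
proof -
  have ff: "f x * cnj (f x) = 1" "cnj (f x) * f x = 1" if "x \<in> L" for x
    using unit[OF that] by (simp_all add: complex_norm_square[symmetric] mult.commute)
  have pi: "\<pi> x \<in> L" if "x \<in> L" for x using bij that bij_betwE by blast
  have inj: "\<pi> x = \<pi> y \<longleftrightarrow> x = y" if "x \<in> L" "y \<in> L" for x y
    using bij that by (auto simp: bij_betw_def inj_on_def)
  show ?thesis
    unfolding unitary_on_def
  proof (intro conjI ballI)
    fix x y assume xy: "x \<in> L" "y \<in> L"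
    have "(\<Sum>z\<in>L. (if z = \<pi> x then f x else 0) * cnj (if z = \<pi> y then f y else 0))
        = (\<Sum>z\<in>L. if z = \<pi> x then (if x = y then 1 else 0) else 0)"
      using xy by (intro sum.cong) (auto simp: ff inj)
    thus "(\<Sum>z\<in>L. (if z = \<pi> x then f x else 0) * cnj (if z = \<pi> y then f y else 0))
        = (if x = y then 1 else 0)"
      using fin pi xy by simp
  next
    fix x y assume xy: "x \<in> L" "y \<in> L"
    obtain w where w: "w \<in> L" "x = \<pi> w" using bij xy by (auto simp: bij_betw_def)
    have "(\<Sum>z\<in>L. cnj (if x = \<pi> z then f z else 0) * (if y = \<pi> z then f z else 0))
        = (\<Sum>z\<in>L. if z = w then (if x = y then 1 else 0) else 0)"
      using xy w by (intro sum.cong) (auto simp: ff inj)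
    thus "(\<Sum>z\<in>L. cnj (if x = \<pi> z then f z else 0) * (if y = \<pi> z then f z else 0))
        = (if x = y then 1 else 0)"
      using fin w by simp
  qed
qed

lemma unitary_wmat:
  assumes "D > 0" "finite \<alpha>" "norm c = 1"
  shows "unitary_on (PiE \<alpha> (\<lambda>_. {..<D})) (\<lambda>j k. c * wmat \<alpha> D x z j k)"
proof -
  have "(\<lambda>j k. c * wmat \<alpha> D x z j k) = (\<lambda>j k. if k = shift \<alpha> D x j then c * wphase \<alpha> D x z j else 0)"
    by (auto simp: wmat_def fun_eq_iff)
  thus ?thesis
    using assms by (auto intro!: unitary_monomial bij_betw_shift finite_PiE simp: norm_mult)
qed

definition ctrl_fourier ::
  "nat \<Rightarrow> int \<Rightarrow> (nat \<Rightarrow> 'b \<Rightarrow> 'b \<Rightarrow> complex) \<Rightarrow> 'b \<times> nat \<Rightarrow> 'b \<times> nat \<Rightarrow> complex" where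
  "ctrl_fourier q \<epsilon> H = (\<lambda>(j, a) (l, s). ph q (2 * (\<epsilon> * int s * int a)) / sqrt (real q) * H a j l)"

lemma root_sum_nat:
  assumes "\<epsilon> = 1 \<or> \<epsilon> = -1" "a < q" "b < q"
  shows "(\<Sum>s<q. ph q (2 * (int s * (\<epsilon> * (int a - int b)))) / of_nat q) = (if a = b then 1 else 0)"
proof -
  have "int q dvd \<epsilon> * (int a - int b) \<longleftrightarrow> int q dvd int a - int b"
    using assms(1) by (auto simp: dvd_diff_commute)
  also have "\<dots> \<longleftrightarrow> a = b"
    using assms zdvd_not_zless by (auto simp: mod_eq_dvd_iff[symmetric])
  finally show ?thesis using assms by (auto simp: root_sum simp flip: sum_divide_distrib)
qed

lemma unitary_ctrl_fourier:
  assumes fin: "finite L" and \<epsilon>: "\<epsilon> = 1 \<or> \<epsilon> = -1" and q: "q > 0"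
    and H: "\<And>a. a < q \<Longrightarrow> unitary_on L (H a)"
  shows "unitary_on (L \<times> {..<q}) (ctrl_fourier q \<epsilon> H)"
  unfolding unitary_on_def
proof (intro conjI ballI)
  have sq: "complex_of_real (sqrt (real q)) * complex_of_real (sqrt (real q)) = of_nat q"
    by (simp flip: of_real_mult)
  fix x y assume "x \<in> L \<times> {..<q}" "y \<in> L \<times> {..<q}"
  then obtain j k a b where xy: "x = (j, a)" "y = (k, b)"
    and h: "j \<in> L" "k \<in> L" "a < q" "b < q" by auto
  have "(\<Sum>z\<in>L \<times> {..<q}. ctrl_fourier q \<epsilon> H x z * cnj (ctrl_fourier q \<epsilon> H y z))
    = (\<Sum>l\<in>L. \<Sum>s<q. ph q (2 * (int s * (\<epsilon> * (int a - int b)))) / of_nat q * (H a j l * cnj (H b k l)))"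
    unfolding sum.cartesian_product' xy
    by (intro sum.cong refl)
       (simp add: ctrl_fourier_def cnj_ph sq[symmetric] algebra_simps flip: ph_add)
  also have "\<dots> = (\<Sum>l\<in>L. (if a = b then 1 else 0) * (H a j l * cnj (H b k l)))"
    using h by (simp only: sum_distrib_right[symmetric] root_sum_nat[OF \<epsilon>])
  also have "\<dots> = (if x = y then 1 else 0)"
    using h H[of a] by (auto simp: unitary_on_def xy)
  finally show "(\<Sum>z\<in>L \<times> {..<q}. ctrl_fourier q \<epsilon> H x z * cnj (ctrl_fourier q \<epsilon> H y z))
    = (if x = y then 1 else 0)" .
  have "(\<Sum>z\<in>L \<times> {..<q}. cnj (ctrl_fourier q \<epsilon> H z x) * ctrl_fourier q \<epsilon> H z y)
    = (\<Sum>s<q. \<Sum>l\<in>L. ph q (2 * (int s * (\<epsilon> * (int b - int a)))) / of_nat q * (cnj (H s l j) * H s l k))"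
    unfolding sum.cartesian_product' xy sum.swap[of _ L]
    by (intro sum.cong refl)
       (simp add: ctrl_fourier_def cnj_ph sq[symmetric] algebra_simps flip: ph_add)
  also have "\<dots> = (\<Sum>s<q. ph q (2 * (int s * (\<epsilon> * (int b - int a)))) / of_nat q * (if j = k then 1 else 0))"
    using h H unfolding unitary_on_def sum_distrib_left[symmetric] by (intro sum.cong refl) simp
  also have "\<dots> = (if x = y then 1 else 0)"
    using h by (simp only: sum_distrib_right[symmetric] root_sum_nat[OF \<epsilon>]) (auto simp: xy)
  finally show "(\<Sum>z\<in>L \<times> {..<q}. cnj (ctrl_fourier q \<epsilon> H z x) * ctrl_fourier q \<epsilon> H z y)
    = (if x = y then 1 else 0)" .
qed

lemma weyl_0: "j \<in> PiE \<alpha> (\<lambda>_. {..<D}) \<Longrightarrow> weyl \<alpha> D (\<lambda>_. 0) (\<lambda>_. 0) f j = f j"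
  by (simp add: weyl_def wphase_def shift_0)

subsection \<open>Stabilizer states as eigenvectors\<close>

text \<open>Conjugation invariance under the Weyl operator with label \<open>(x, z)\<close>, in matrix entries.\<close>

definition weyl_invariant :: "nat \<Rightarrow> nat \<Rightarrow> (nat \<Rightarrow> int) \<Rightarrow> (nat \<Rightarrow> int) \<Rightarrow> qop \<Rightarrow> bool" where
  "weyl_invariant N D x z s \<longleftrightarrow> (\<forall>j\<in>cfgs N D. \<forall>k\<in>cfgs N D.
     s (shift {..<N} D x j) (shift {..<N} D x k) =
       cnj (wphase {..<N} D x z j) * wphase {..<N} D x z k * s j k)"

lemma shift_cfgs [simp]: "D > 0 \<Longrightarrow> shift {..<N} D x j \<in> cfgs N D"
  by (simp add: cfgs_def)

lemma bij_betw_shift_cfgs: "D > 0 \<Longrightarrow> bij_betw (shift {..<N} D x) (cfgs N D) (cfgs N D)"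
  by (simp add: cfgs_def bij_betw_shift)

lemma cnj_wphase_mult [simp]:
  "cnj (wphase \<alpha> D x z j) * wphase \<alpha> D x z j = 1" "wphase \<alpha> D x z j * cnj (wphase \<alpha> D x z j) = 1"
  by (simp_all add: wphase_def cnj_ph)

lemma weyl_invariant_id:
  assumes "D > 0"
  shows "weyl_invariant N D x z (op_id N D)"
proof -
  have "shift {..<N} D x j = shift {..<N} D x k \<longleftrightarrow> j = k" if "j \<in> cfgs N D" "k \<in> cfgs N D" for j k
    using bij_betw_shift_cfgs[OF assms, of N x] that by (auto simp: bij_betw_def inj_on_def)
  thus ?thesis
    using assms by (auto simp: weyl_invariant_def op_id_def restr_op_def)
qed

lemma weyl_invariant_mul:
  assumes D: "D > 0" and a: "weyl_invariant N D x z a" and b: "weyl_invariant N D x z b"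
  shows "weyl_invariant N D x z (op_mul N D a b)"
  unfolding weyl_invariant_def
proof (intro ballI)
  fix j k assume jk: "j \<in> cfgs N D" "k \<in> cfgs N D"
  let ?s = "shift {..<N} D x" and ?e = "wphase {..<N} D x z"
  have "op_mul N D a b (?s j) (?s k) = (\<Sum>l\<in>cfgs N D. a (?s j) l * b l (?s k))"
    using D by (simp add: op_mul_def restr_op_def)
  also have "\<dots> = (\<Sum>l\<in>cfgs N D. a (?s j) (?s l) * b (?s l) (?s k))"
    by (rule sum.reindex_bij_betw[OF bij_betw_shift_cfgs[OF D], symmetric])
  also have "\<dots> = (\<Sum>l\<in>cfgs N D. cnj (?e j) * ?e k * (a j l * b l k))"
  proof (intro sum.cong refl)
    fix l assume l: "l \<in> cfgs N D"
    have "a (?s j) (?s l) * b (?s l) (?s k) =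
        cnj (?e j) * ?e k * (a j l * b l k) * (?e l * cnj (?e l))"
      using a b jk l by (simp add: weyl_invariant_def)
    thus "a (?s j) (?s l) * b (?s l) (?s k) = cnj (?e j) * ?e k * (a j l * b l k)" by simp
  qed
  also have "\<dots> = cnj (?e j) * ?e k * op_mul N D a b j k"
    using jk by (simp add: op_mul_def restr_op_def sum_distrib_left)
  finally show "op_mul N D a b (?s j) (?s k) = cnj (?e j) * ?e k * op_mul N D a b j k" .
qed

lemma weyl_invariant_pauli:
  assumes D: "D > 0" and comm: "int D dvd (\<Sum>i<N. gx i * z i - gz i * x i)"
  shows "weyl_invariant N D x z (pauli N D \<gamma> gx gz)"
  unfolding weyl_invariant_def
proof (intro ballI)
  fix j k assume jk: "j \<in> cfgs N D" "k \<in> cfgs N D"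
  let ?s = "shift {..<N} D x" and ?e = "wphase {..<N} D x z"
  have lt: "j i < D" if "i < N" for i
    using jk that by (auto simp: cfgs_def)
  have cis_ph: "cis (2 * pi * of_int e / real D) = ph D (2 * e)" for e
    by (simp add: ph_def mult.assoc mult.left_commute)
  have cond: "int (?s j i) = (int (?s k i) + gx i) mod int D \<longleftrightarrow>
      int (j i) = (int (k i) + gx i) mod int D" if "i < N" for i
  proof -
    have "int (?s j i) = (int (?s k i) + gx i) mod int D \<longleftrightarrow>
        [int (j i) - x i = int (k i) - x i + gx i] (mod int D)"
      using that D by (simp add: int_shift cong_def mod_add_left_eq)
    also have "\<dots> \<longleftrightarrow> [int (j i) = int (k i) + gx i] (mod int D)"
    proof -
      have "int (j i) - x i - (int (k i) - x i + gx i) = int (j i) - (int (k i) + gx i)" by simp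
      thus ?thesis by (simp only: cong_iff_dvd_diff)
    qed
    also have "\<dots> \<longleftrightarrow> int (j i) = (int (k i) + gx i) mod int D"
      using lt[OF that] by (simp add: cong_def)
    finally show ?thesis .
  qed
  show "pauli N D \<gamma> gx gz (?s j) (?s k) = cnj (?e j) * ?e k * pauli N D \<gamma> gx gz j k"
  proof (cases "\<forall>i<N. int (j i) = (int (k i) + gx i) mod int D")
    case False
    thus ?thesis using jk D cond by (auto simp: pauli_def restr_op_def)
  next
    case True
    have "ph D (2 * (\<Sum>i<N. gz i * int (?s k i))) = ph D (2 * (\<Sum>i<N. gz i * (int (k i) - x i)))"
      using D by (intro ph_double_cong cong_sum cong_mult) (auto simp: int_shift cong_def)
    also have "\<dots> = ph D (2 * ((\<Sum>i<N. z i * (int (k i) - int (j i))) + (\<Sum>i<N. gz i * int (k i))))"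
    proof (intro ph_double_cong D)
      have shifted: "[\<Sum>i<N. z i * (int (k i) - int (j i)) = \<Sum>i<N. z i * (- gx i)] (mod int D)"
      proof (intro cong_sum cong_mult cong_refl)
        fix i assume "i \<in> {..<N}"
        hence "[int (j i) = int (k i) + gx i] (mod int D)" using True by (simp add: cong_def)
        thus "[int (k i) - int (j i) = - gx i] (mod int D)"
          by (simp add: cong_iff_dvd_diff dvd_diff_commute[of _ "int (j i)"] algebra_simps)
      qed
      have "[\<Sum>i<N. gz i * (int (k i) - x i) = (\<Sum>i<N. z i * (- gx i)) + (\<Sum>i<N. gz i * int (k i))] (mod int D)"
        using comm by (simp add: cong_iff_dvd_diff sum_subtractf right_diff_distrib sum_negf mult.commute)
      from cong_trans[OF this cong_add[OF cong_sym[OF shifted] cong_refl]]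
      show "[\<Sum>i<N. gz i * (int (k i) - x i) =
          (\<Sum>i<N. z i * (int (k i) - int (j i))) + (\<Sum>i<N. gz i * int (k i))] (mod int D)" .
    qed
    also have "\<dots> = cnj (?e j) * ?e k * ph D (2 * (\<Sum>i<N. gz i * int (k i)))"
      unfolding wphase_def cnj_ph ph_add[symmetric]
      by (simp add: sum_subtractf sum_distrib_left algebra_simps)
    finally show ?thesis
      using True cond D jk unfolding pauli_def cis_ph by (simp add: restr_op_def)
  qed
qed

lemma stabilizer_state_eigenvector:
  assumes D: "D > 0"
    and psi: "is_stabilizer_state N D (gen_group N D {pauli N D (g\<gamma> i) (gx i) (gz i) | i. i < K}) \<psi>"
    and comm: "\<And>k. k < K \<Longrightarrow> int D dvd (\<Sum>i<N. gx k i * z i - gz k i * x i)"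
  shows "\<exists>c. norm c = 1 \<and> (\<forall>j\<in>cfgs N D. weyl {..<N} D x z \<psi> j = c * \<psi> j)"
proof -
  let ?S = "gen_group N D {pauli N D (g\<gamma> i) (gx i) (gz i) | i. i < K}"
  let ?s = "shift {..<N} D x" and ?e = "wphase {..<N} D x z"
  have inv: "weyl_invariant N D x z s" if "s \<in> ?S" for s
    using that
    by induction (use D comm in \<open>auto intro!: weyl_invariant_id weyl_invariant_mul weyl_invariant_pauli\<close>)
  define f where "f = weyl {..<N} D x z \<psi>"
  have ff: "f j * cnj (f k) = \<psi> j * cnj (\<psi> k)" if jk: "j \<in> cfgs N D" "k \<in> cfgs N D" for j k
  proof -
    have "f j * cnj (f k) = ?e j * cnj (?e k) * (\<psi> (?s j) * cnj (\<psi> (?s k)))"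
      by (simp add: f_def weyl_def)
    also have "\<psi> (?s j) * cnj (\<psi> (?s k)) = (\<Sum>s\<in>?S. s (?s j) (?s k)) / of_nat (D ^ N)"
      using psi D unfolding is_stabilizer_state_def by simp
    also have "\<dots> = (\<Sum>s\<in>?S. cnj (?e j) * ?e k * s j k) / of_nat (D ^ N)"
      using inv jk by (simp add: weyl_invariant_def)
    also have "\<dots> = cnj (?e j) * ?e k * (\<psi> j * cnj (\<psi> k))"
      using psi jk unfolding is_stabilizer_state_def by (simp flip: sum_distrib_left)
    also have "?e j * cnj (?e k) * (cnj (?e j) * ?e k * (\<psi> j * cnj (\<psi> k)))
        = (cnj (?e j) * ?e j) * (cnj (?e k) * ?e k) * (\<psi> j * cnj (\<psi> k))"
      by (simp only: ac_simps)
    finally show ?thesis by simp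
  qed
  have nn: "norm (f j) = norm (\<psi> j)" if "j \<in> cfgs N D" for j
  proof -
    have "of_real ((norm (f j))\<^sup>2) = (of_real ((norm (\<psi> j))\<^sup>2) :: complex)"
      using ff[OF that that] by (simp only: complex_norm_square)
    thus ?thesis by (simp only: of_real_eq_iff power2_eq_iff_nonneg norm_ge_zero)
  qed
  show ?thesis
  proof (cases "\<exists>k\<in>cfgs N D. \<psi> k \<noteq> 0")
    case False
    thus ?thesis using nn by (intro exI[of _ 1]) (auto simp: f_def)
  next
    case True
    then obtain k where k: "k \<in> cfgs N D" "\<psi> k \<noteq> 0" by blast
    hence fk: "f k \<noteq> 0" using nn by force
    have "f j = cnj (\<psi> k) / cnj (f k) * \<psi> j" if "j \<in> cfgs N D" for j
      using ff[OF that k(1)] fk by (simp add: field_simps)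
    moreover have "norm (cnj (\<psi> k) / cnj (f k)) = 1"
      using nn k by (simp add: norm_divide)
    ultimately show ?thesis unfolding f_def by blast
  qed
qed

subsection \<open>Tensor products of local Weyl operators\<close>

definition lift_label :: "(nat \<Rightarrow> nat) \<Rightarrow> nat set \<Rightarrow> (nat \<Rightarrow> nat \<Rightarrow> int) \<Rightarrow> nat \<Rightarrow> int" where
  "lift_label part B x i = (if part i \<in> B then x (part i) i else 0)"

lemma sum_parties:
  fixes f :: "nat \<Rightarrow> 'a::comm_monoid_add"
  assumes "finite B"
  shows "(\<Sum>i<N. if part i \<in> B then f i else 0) = (\<Sum>\<beta>\<in>B. \<Sum>i\<in>party N part \<beta>. f i)"
proof -
  have "(\<Sum>\<beta>\<in>B. \<Sum>i\<in>party N part \<beta>. f i)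
      = (\<Sum>\<beta>\<in>B. sum f {i \<in> {i \<in> {..<N}. part i \<in> B}. part i = \<beta>})"
    by (intro sum.cong refl) (auto simp: party_def)
  also have "\<dots> = sum f {i \<in> {..<N}. part i \<in> B}"
    using assms by (intro sum.group) auto
  finally show ?thesis by (simp only: sum.inter_filter finite_lessThan)
qed

lemma wphase_tensor:
  assumes "finite B"
  shows "(\<Prod>\<beta>\<in>B. wphase (party N part \<beta>) D (x \<beta>) (z \<beta>) (restrict j (party N part \<beta>)))
    = wphase {..<N} D (lift_label part B x) (lift_label part B z) j"
proof -
  have "(\<Sum>i<N. lift_label part B z i * (2 * int (j i) - lift_label part B x i))
      = (\<Sum>i<N. if part i \<in> B then z (part i) i * (2 * int (j i) - x (part i) i) else 0)"
    by (intro sum.cong refl) (simp add: lift_label_def)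
  also have "\<dots> = (\<Sum>\<beta>\<in>B. \<Sum>i\<in>party N part \<beta>. z (part i) i * (2 * int (j i) - x (part i) i))"
    by (rule sum_parties[OF assms])
  also have "\<dots> = (\<Sum>\<beta>\<in>B. \<Sum>i\<in>party N part \<beta>. z \<beta> i * (2 * int (restrict j (party N part \<beta>) i) - x \<beta> i))"
    by (intro sum.cong refl) (simp add: party_def)
  finally show ?thesis by (simp add: wphase_def ph_sum)
qed

lemma restrict_shift_lift:
  assumes "\<beta> \<in> B"
  shows "restrict (shift {..<N} D (lift_label part B x) j) (party N part \<beta>)
    = shift (party N part \<beta>) D (x \<beta>) (restrict j (party N part \<beta>))"
  using assms by (auto simp: fun_eq_iff shift_def lift_label_def party_def restrict_def)

lemma shift_lift_outside:
  assumes "j \<in> cfgs N D" "i < N" "part i \<notin> B"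
  shows "shift {..<N} D (lift_label part B x) j i = j i"
proof -
  have "j i < D" using assms by (auto simp: cfgs_def)
  hence "int (j i) mod int D = int (j i)" by simp
  thus ?thesis using assms(2,3) by (simp only: shift_def lift_label_def restrict_apply lessThan_iff diff_zero nat_int if_True if_False)
qed

lemma wmat_tensor:
  assumes B: "finite B" and j: "j \<in> cfgs N D" and k: "k \<in> cfgs N D"
  shows "(\<Prod>\<beta>\<in>B. wmat (party N part \<beta>) D (x \<beta>) (z \<beta>) (restrict j (party N part \<beta>)) (restrict k (party N part \<beta>)))
      * (if \<forall>i<N. part i \<notin> B \<longrightarrow> j i = k i then 1 else 0)
    = wmat {..<N} D (lift_label part B x) (lift_label part B z) j k"
proof -
  let ?J = "shift {..<N} D (lift_label part B x) j"
  have iff: "k = ?J \<longleftrightarrow> (\<forall>\<beta>\<in>B. restrict k (party N part \<beta>) = shift (party N part \<beta>) D (x \<beta>) (restrict j (party N part \<beta>)))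
      \<and> (\<forall>i<N. part i \<notin> B \<longrightarrow> j i = k i)" (is "?l \<longleftrightarrow> ?r1 \<and> ?r2")
  proof safe
    assume r: ?r1 ?r2
    show ?l
    proof
      fix i
      consider "i \<ge> N" | "i < N" "part i \<notin> B" | "i < N" "part i \<in> B" by linarith
      thus "k i = ?J i"
      proof cases
        case 1
        thus ?thesis using k by (auto simp: cfgs_def shift_def PiE_def extensional_def)
      next
        case 2
        thus ?thesis using r shift_lift_outside[OF j] by metis
      next
        case 3
        hence "restrict k (party N part (part i)) i = restrict ?J (party N part (part i)) i"
          using r by (simp add: restrict_shift_lift)
        thus ?thesis using 3 by (simp add: party_def)
      qed
    qed
  qed (simp_all add: restrict_shift_lift shift_lift_outside[OF j])
  show ?thesis
  proof (cases ?l)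
    case True
    thus ?thesis using iff by (simp add: wmat_def wphase_tensor[OF B, symmetric])
  next
    case False
    hence "\<not> ?r2 \<or> \<not> ?r1" using iff by blast
    thus ?thesis using False B by (auto simp: wmat_def)
  qed
qed

lemma wmat_mult:
  assumes "D > 0" "finite \<alpha>"
  shows "(\<Sum>l\<in>PiE \<alpha> (\<lambda>_. {..<D}). wmat \<alpha> D x z j l * wmat \<alpha> D x' z' l k)
    = wphase \<alpha> D x z j * wmat \<alpha> D x' z' (shift \<alpha> D x j) k"
proof -
  have "(\<Sum>l\<in>PiE \<alpha> (\<lambda>_. {..<D}). wmat \<alpha> D x z j l * wmat \<alpha> D x' z' l k)
    = (\<Sum>l\<in>PiE \<alpha> (\<lambda>_. {..<D}). if l = shift \<alpha> D x j then wphase \<alpha> D x z j * wmat \<alpha> D x' z' l k else 0)"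
    by (intro sum.cong refl) (simp add: wmat_def)
  thus ?thesis using assms by (simp add: finite_PiE)
qed

lemma finite_party [simp]: "finite (party N part \<beta>)"
  by (simp add: party_def)

lemma finite_cfgs [simp]: "finite (cfgs N D)"
  by (simp add: cfgs_def finite_PiE)

lemma tensor_weyl_apply:
  assumes D: "D > 0" and B: "finite B" and j: "j \<in> cfgs N D"
  shows "(\<Sum>k\<in>cfgs N D.
      (\<Prod>\<beta>\<in>B. \<Sum>l\<in>PiE (party N part \<beta>) (\<lambda>_. {..<D}).
         wmat (party N part \<beta>) D (x \<beta>) (z \<beta>) (restrict j (party N part \<beta>)) l *
         wmat (party N part \<beta>) D (x' \<beta>) (z' \<beta>) l (restrict k (party N part \<beta>))) *
      (if \<forall>i<N. part i \<notin> B \<longrightarrow> j i = k i then 1 else 0) * f k)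
    = weyl {..<N} D (lift_label part B x) (lift_label part B z)
        (weyl {..<N} D (lift_label part B x') (lift_label part B z') f) j"
proof -
  let ?J = "shift {..<N} D (lift_label part B x) j"
  let ?e = "wphase {..<N} D (lift_label part B x) (lift_label part B z) j"
  have "(\<Sum>k\<in>cfgs N D.
      (\<Prod>\<beta>\<in>B. \<Sum>l\<in>PiE (party N part \<beta>) (\<lambda>_. {..<D}).
         wmat (party N part \<beta>) D (x \<beta>) (z \<beta>) (restrict j (party N part \<beta>)) l *
         wmat (party N part \<beta>) D (x' \<beta>) (z' \<beta>) l (restrict k (party N part \<beta>))) *
      (if \<forall>i<N. part i \<notin> B \<longrightarrow> j i = k i then 1 else 0) * f k)
    = (\<Sum>k\<in>cfgs N D. ?e * wmat {..<N} D (lift_label part B x') (lift_label part B z') ?J k * f k)"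
  proof (intro sum.cong refl)
    fix k assume k: "k \<in> cfgs N D"
    have "(\<forall>i<N. part i \<notin> B \<longrightarrow> j i = k i) \<longleftrightarrow> (\<forall>i<N. part i \<notin> B \<longrightarrow> ?J i = k i)"
      using shift_lift_outside[OF j] by auto
    moreover have "(\<Prod>\<beta>\<in>B. \<Sum>l\<in>PiE (party N part \<beta>) (\<lambda>_. {..<D}).
         wmat (party N part \<beta>) D (x \<beta>) (z \<beta>) (restrict j (party N part \<beta>)) l *
         wmat (party N part \<beta>) D (x' \<beta>) (z' \<beta>) l (restrict k (party N part \<beta>)))
       = ?e * (\<Prod>\<beta>\<in>B. wmat (party N part \<beta>) D (x' \<beta>) (z' \<beta>) (restrict ?J (party N part \<beta>)) (restrict k (party N part \<beta>)))"
      by (simp add: wmat_mult D prod.distrib wphase_tensor[OF B] restrict_shift_lift cong: prod.cong)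
    ultimately show "(\<Prod>\<beta>\<in>B. \<Sum>l\<in>PiE (party N part \<beta>) (\<lambda>_. {..<D}).
         wmat (party N part \<beta>) D (x \<beta>) (z \<beta>) (restrict j (party N part \<beta>)) l *
         wmat (party N part \<beta>) D (x' \<beta>) (z' \<beta>) l (restrict k (party N part \<beta>))) *
      (if \<forall>i<N. part i \<notin> B \<longrightarrow> j i = k i then 1 else 0) * f k =
      ?e * wmat {..<N} D (lift_label part B x') (lift_label part B z') ?J k * f k"
      using wmat_tensor[OF B shift_cfgs[OF D] k] by (simp only: mult.assoc)
  qed
  also have "\<dots> = (\<Sum>k\<in>cfgs N D. if k = shift {..<N} D (lift_label part B x') ?J
      then ?e * wphase {..<N} D (lift_label part B x') (lift_label part B z') ?J * f k else 0)"
    by (intro sum.cong refl) (simp add: wmat_def)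
  finally show ?thesis using D by (simp add: weyl_def mult.assoc)
qed

subsection \<open>GHZ states\<close>

lemma mod_eq_if_digits_eq:
  fixes x y :: nat
  assumes "\<And>r. r < n \<Longrightarrow> x div p ^ r mod p = y div p ^ r mod p"
  shows "x mod p ^ n = y mod p ^ n"
  using assms
proof (induction n)
  case (Suc n)
  thus ?case using mod_mult2_eq[of x "p ^ n" p] mod_mult2_eq[of y "p ^ n" p]
    by (simp add: mult.commute)
qed simp

lemma ghz_pow_eq:
  assumes p: "p > 0" and a: "a \<in> PiE B (\<lambda>_. {..<p ^ n})" and \<beta>0: "\<beta>0 \<in> B"
  shows "ghz_pow p n B a = (if \<forall>\<beta>\<in>B. a \<beta> = a \<beta>0 then complex_of_real (1 / sqrt (real (p ^ n))) else 0)"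
proof (cases "\<forall>\<beta>\<in>B. a \<beta> = a \<beta>0")
  case True
  have "ghz p B (\<lambda>\<beta>. a \<beta> div p ^ r mod p) = complex_of_real (1 / sqrt (real p))" for r
    using True p by (auto simp: ghz_def intro!: exI[of _ "a \<beta>0 div p ^ r mod p"])
  thus ?thesis using True
    by (simp add: ghz_pow_def power_one_over real_sqrt_power flip: of_real_power)
next
  case False
  then obtain \<beta> where \<beta>: "\<beta> \<in> B" "a \<beta> \<noteq> a \<beta>0" by blast
  have "a \<beta> mod p ^ n \<noteq> a \<beta>0 mod p ^ n"
    using \<beta> \<beta>0 a by (auto simp: PiE_iff)
  then obtain r where "r < n" "a \<beta> div p ^ r mod p \<noteq> a \<beta>0 div p ^ r mod p"
    using mod_eq_if_digits_eq by blast
  moreover from this have "ghz p B (\<lambda>\<beta>. a \<beta> div p ^ r mod p) = 0"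
    using \<beta> \<beta>0 by (auto simp: ghz_def)
  ultimately show ?thesis
    using False by (auto simp: ghz_pow_def)
qed

lemma periodic_fourier:
  fixes f :: "nat \<Rightarrow> complex"
  assumes q: "q > 0" and per: "\<And>s. f (s + q) = f s"
  shows "f s = (\<Sum>k<q. ph q (2 * (int k * int s)) * ((\<Sum>t<q. ph q (- 2 * (int k * int t)) * f t) / of_nat q))"
proof -
  have mult: "f (t + m * q) = f t" for t m
  proof (induction m)
    case (Suc m)
    thus ?case using per[of "t + m * q"] by (simp add: algebra_simps)
  qed simp
  have "f s = f (s mod q)"
    using mult[of "s mod q" "s div q"] by simp
  also have "\<dots> = (\<Sum>t<q. (\<Sum>k<q. ph q (2 * (int k * (int s - int t)))) / of_nat q * f t)"
  proof -
    have "int q dvd int s - int t \<longleftrightarrow> t = s mod q" if "t < q" for t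
    proof -
      have "int q dvd int s - int t \<longleftrightarrow> int (s mod q) = int (t mod q)"
        by (simp only: mod_eq_dvd_iff[symmetric] of_nat_mod)
      thus ?thesis using that by auto
    qed
    hence "(\<Sum>t<q. (\<Sum>k<q. ph q (2 * (int k * (int s - int t)))) / of_nat q * f t)
        = (\<Sum>t<q. if t = s mod q then f t else 0)"
      using q by (intro sum.cong refl) (simp add: root_sum)
    thus ?thesis using q by simp
  qed
  also have "\<dots> = (\<Sum>t<q. \<Sum>k<q. ph q (2 * (int k * int s)) * (ph q (- 2 * (int k * int t)) * f t / of_nat q))"
    unfolding sum_divide_distrib sum_distrib_right
    by (intro sum.cong refl) (simp add: algebra_simps flip: ph_add)
  also have "\<dots> = (\<Sum>k<q. ph q (2 * (int k * int s)) * ((\<Sum>t<q. ph q (- 2 * (int k * int t)) * f t) / of_nat q))"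
    by (subst sum.swap) (simp only: sum_distrib_left sum_divide_distrib)
  finally show ?thesis .
qed

lemma ghz_fourier:
  fixes f :: "nat \<Rightarrow> complex"
  assumes q: "q > 0" and per: "\<And>s. f (s + q) = f s" and B: "finite B"
    and a: "a \<in> PiE B (\<lambda>_. {..<q})" and \<beta>0: "\<beta>0 \<in> B"
  shows "(\<Sum>s\<in>PiE B (\<lambda>_. {..<q}). (\<Prod>\<beta>\<in>B. ph q (- 2 * (int (s \<beta>) * int (a \<beta>))) / of_nat q) * f (\<Sum>\<beta>\<in>B. s \<beta>))
    = (if \<forall>\<beta>\<in>B. a \<beta> = a \<beta>0 then (\<Sum>t<q. ph q (- 2 * (int (a \<beta>0) * int t)) * f t) / of_nat q else 0)"
proof -
  have if_conj: "(if P \<and> Q then 1 else 0) * x = (if P then if Q then x else 0 else 0)"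
    for P Q and x :: complex by simp
  define F where "F k = (\<Sum>t<q. ph q (- 2 * (int k * int t)) * f t) / of_nat q" for k :: nat
  let ?P = "PiE B (\<lambda>_. {..<q})"
  have "(\<Sum>s\<in>?P. (\<Prod>\<beta>\<in>B. ph q (- 2 * (int (s \<beta>) * int (a \<beta>))) / of_nat q) * f (\<Sum>\<beta>\<in>B. s \<beta>))
      = (\<Sum>s\<in>?P. \<Sum>k<q. (\<Prod>\<beta>\<in>B. ph q (2 * (int (s \<beta>) * (1 * (int k - int (a \<beta>))))) / of_nat q) * F k)"
  proof (intro sum.cong refl)
    fix s
    let ?A = "\<Prod>\<beta>\<in>B. ph q (- 2 * (int (s \<beta>) * int (a \<beta>))) / of_nat q"
    have "f (\<Sum>\<beta>\<in>B. s \<beta>) = (\<Sum>k<q. ph q (2 * (int k * int (\<Sum>\<beta>\<in>B. s \<beta>))) * F k)"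
      unfolding F_def using q per by (rule periodic_fourier)
    also have "\<dots> = (\<Sum>k<q. (\<Prod>\<beta>\<in>B. ph q (2 * (int k * int (s \<beta>)))) * F k)"
      by (simp add: sum_distrib_left ph_sum)
    also have "?A * \<dots> = (\<Sum>k<q. ?A * (\<Prod>\<beta>\<in>B. ph q (2 * (int k * int (s \<beta>)))) * F k)"
      by (simp only: sum_distrib_left mult.assoc)
    also have "\<dots> = (\<Sum>k<q. (\<Prod>\<beta>\<in>B. ph q (2 * (int (s \<beta>) * (1 * (int k - int (a \<beta>))))) / of_nat q) * F k)"
      unfolding prod.distrib[symmetric]
      by (intro sum.cong prod.cong refl arg_cong2[where f = "(*)"]) (simp add: algebra_simps flip: ph_add)
    finally show "?A * f (\<Sum>\<beta>\<in>B. s \<beta>)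
      = (\<Sum>k<q. (\<Prod>\<beta>\<in>B. ph q (2 * (int (s \<beta>) * (1 * (int k - int (a \<beta>))))) / of_nat q) * F k)" .
  qed
  also have "\<dots> = (\<Sum>k<q. (\<Sum>s\<in>?P. \<Prod>\<beta>\<in>B. ph q (2 * (int (s \<beta>) * (1 * (int k - int (a \<beta>))))) / of_nat q) * F k)"
    by (subst sum.swap) (simp only: sum_distrib_right)
  also have "\<dots> = (\<Sum>k<q. (\<Prod>\<beta>\<in>B. \<Sum>s<q. ph q (2 * (int s * (1 * (int k - int (a \<beta>))))) / of_nat q) * F k)"
    using B by (subst prod_sum_PiE) auto
  also have "\<dots> = (\<Sum>k<q. if k = a \<beta>0 then (if \<forall>\<beta>\<in>B. a \<beta> = a \<beta>0 then F k else 0) else 0)"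
  proof (intro sum.cong refl)
    fix k assume "k \<in> {..<q}"
    have iff: "(\<forall>\<beta>\<in>B. k = a \<beta>) \<longleftrightarrow> k = a \<beta>0 \<and> (\<forall>\<beta>\<in>B. a \<beta> = a \<beta>0)"
      using \<beta>0 by metis
    from \<open>k \<in> {..<q}\<close>
    have "(\<Prod>\<beta>\<in>B. \<Sum>s<q. ph q (2 * (int s * (1 * (int k - int (a \<beta>))))) / of_nat q)
        = (\<Prod>\<beta>\<in>B. if k = a \<beta> then 1 else 0)"
      using a by (intro prod.cong refl, subst root_sum_nat) (auto simp: PiE_iff)
    also have "\<dots> = (if \<forall>\<beta>\<in>B. k = a \<beta> then 1 else 0)"
      using B by auto
    finally show "(\<Prod>\<beta>\<in>B. \<Sum>s<q. ph q (2 * (int s * (1 * (int k - int (a \<beta>))))) / of_nat q) * F k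
        = (if k = a \<beta>0 then (if \<forall>\<beta>\<in>B. a \<beta> = a \<beta>0 then F k else 0) else 0)"
      by (simp only: iff if_conj)
  qed
  also have "\<dots> = (if \<forall>\<beta>\<in>B. a \<beta> = a \<beta>0 then F (a \<beta>0) else 0)"
    using a \<beta>0 by (simp add: PiE_iff)
  finally show ?thesis by (simp add: F_def)
qed

subsection \<open>Local gates\<close>

definition phase_gate ::
  "nat \<Rightarrow> nat \<Rightarrow> nat set \<Rightarrow> (nat \<Rightarrow> complex) \<Rightarrow> (nat \<Rightarrow> int) \<Rightarrow> (nat \<Rightarrow> int) \<Rightarrow>
   (nat \<Rightarrow> complex) \<Rightarrow> (nat \<Rightarrow> int) \<Rightarrow> (nat \<Rightarrow> int) \<Rightarrow> cfg \<times> nat \<Rightarrow> cfg \<times> nat \<Rightarrow> complex" where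
  "phase_gate D q \<alpha> cH hx hz cT tx tz = (\<lambda>y y'. \<Sum>w\<in>PiE \<alpha> (\<lambda>_. {..<D}) \<times> {..<q}.
     ctrl_fourier q (- 1) (\<lambda>a j k. cH a * wmat \<alpha> D (\<lambda>i. int a * hx i) (\<lambda>i. int a * hz i) j k) y w *
     ctrl_fourier q 1 (\<lambda>s j k. cT s * wmat \<alpha> D (\<lambda>i. int s * tx i) (\<lambda>i. int s * tz i) j k) w y')"

lemma unitary_phase_gate:
  assumes "D > 0" "q > 0" "finite \<alpha>" "\<And>a. norm (cH a) = 1" "\<And>s. norm (cT s) = 1"
  shows "unitary_on (PiE \<alpha> (\<lambda>_. {..<D}) \<times> {..<q}) (phase_gate D q \<alpha> cH hx hz cT tx tz)"
  unfolding phase_gate_def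
  by (intro unitary_mult unitary_ctrl_fourier unitary_wmat finite_cartesian_product finite_PiE)
     (use assms in auto)

lemma phase_gate_ancilla_0:
  assumes "D > 0" "q > 0" "finite \<alpha>"
  shows "phase_gate D q \<alpha> cH hx hz cT tx tz (j, a) (k, 0) =
    (\<Sum>s<q. ph q (- 2 * (int s * int a)) / of_nat q * (cH a * cT s) *
      (\<Sum>l\<in>PiE \<alpha> (\<lambda>_. {..<D}). wmat \<alpha> D (\<lambda>i. int a * hx i) (\<lambda>i. int a * hz i) j l *
        wmat \<alpha> D (\<lambda>i. int s * tx i) (\<lambda>i. int s * tz i) l k))"
proof -
  have sq: "complex_of_real (sqrt (real q)) * complex_of_real (sqrt (real q)) = of_nat q"
    by (simp flip: of_real_mult)
  show ?thesis
    unfolding phase_gate_def sum.cartesian_product' sum_distrib_left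
    by (subst sum.swap, intro sum.cong refl) (simp add: ctrl_fourier_def sq[symmetric])
qed

lemma phase_gates_apply:
  assumes D: "D > 0" and q: "q > 0" and B: "finite B" and j: "j \<in> cfgs N D"
  shows "(\<Sum>kb\<in>full_cfgs N D B q.
      local_tensor N part B (\<lambda>\<beta>. phase_gate D q (party N part \<beta>) (cH \<beta>) hx hz (cT \<beta>) tx tz) (j, a) kb
      * with_ancillas B \<psi> kb)
    = (\<Sum>s\<in>PiE B (\<lambda>_. {..<q}).
        (\<Prod>\<beta>\<in>B. ph q (- 2 * (int (s \<beta>) * int (a \<beta>))) / of_nat q * (cH \<beta> (a \<beta>) * cT \<beta> (s \<beta>))) *
        weyl {..<N} D (lift_label part B (\<lambda>\<beta> i. int (a \<beta>) * hx i)) (lift_label part B (\<lambda>\<beta> i. int (a \<beta>) * hz i))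
          (weyl {..<N} D (lift_label part B (\<lambda>\<beta> i. int (s \<beta>) * tx i)) (lift_label part B (\<lambda>\<beta> i. int (s \<beta>) * tz i)) \<psi>) j)"
    (is "?lhs = _")
proof -
  let ?U = "\<lambda>\<beta>. phase_gate D q (party N part \<beta>) (cH \<beta>) hx hz (cT \<beta>) tx tz"
  let ?z = "restrict (\<lambda>_. 0 :: nat) B"
  let ?P = "PiE B (\<lambda>_. {..<q})"
  define c where "c \<beta> s = ph q (- 2 * (int s * int (a \<beta>))) / of_nat q * (cH \<beta> (a \<beta>) * cT \<beta> s)" for \<beta> s
  define X where "X \<beta> s k = (\<Sum>l\<in>PiE (party N part \<beta>) (\<lambda>_. {..<D}).
      wmat (party N part \<beta>) D (\<lambda>i. int (a \<beta>) * hx i) (\<lambda>i. int (a \<beta>) * hz i) (restrict j (party N part \<beta>)) l *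
      wmat (party N part \<beta>) D (\<lambda>i. int s * tx i) (\<lambda>i. int s * tz i) l (restrict k (party N part \<beta>)))"
    for \<beta> s k
  define \<delta> :: "cfg \<Rightarrow> complex" where "\<delta> k = (if \<forall>i<N. part i \<notin> B \<longrightarrow> j i = k i then 1 else 0)" for k
  have "?lhs = (\<Sum>k\<in>cfgs N D. \<Sum>b\<in>?P. if b = ?z then local_tensor N part B ?U (j, a) (k, ?z) * \<psi> k else 0)"
    unfolding full_cfgs_def sum.cartesian_product'
    by (intro sum.cong refl) (simp add: with_ancillas_def)
  also have "\<dots> = (\<Sum>k\<in>cfgs N D. local_tensor N part B ?U (j, a) (k, ?z) * \<psi> k)"
    using B q by (simp add: finite_PiE)
  also have "\<dots> = (\<Sum>k\<in>cfgs N D. \<Sum>s\<in>?P. (\<Prod>\<beta>\<in>B. c \<beta> (s \<beta>)) * ((\<Prod>\<beta>\<in>B. X \<beta> (s \<beta>) k) * \<delta> k * \<psi> k))"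
  proof (intro sum.cong refl)
    fix k
    have "local_tensor N part B ?U (j, a) (k, ?z) = (\<Prod>\<beta>\<in>B. \<Sum>s<q. c \<beta> s * X \<beta> s k) * \<delta> k"
      by (simp add: local_tensor_def phase_gate_ancilla_0[OF D q] c_def X_def \<delta>_def)
    also have "(\<Prod>\<beta>\<in>B. \<Sum>s<q. c \<beta> s * X \<beta> s k) = (\<Sum>s\<in>?P. \<Prod>\<beta>\<in>B. c \<beta> (s \<beta>) * X \<beta> (s \<beta>) k)"
      using B by (intro prod_sum_PiE) auto
    finally show "local_tensor N part B ?U (j, a) (k, ?z) * \<psi> k =
        (\<Sum>s\<in>?P. (\<Prod>\<beta>\<in>B. c \<beta> (s \<beta>)) * ((\<Prod>\<beta>\<in>B. X \<beta> (s \<beta>) k) * \<delta> k * \<psi> k))"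
      by (simp only: prod.distrib sum_distrib_right mult.assoc)
  qed
  also have "\<dots> = (\<Sum>s\<in>?P. (\<Prod>\<beta>\<in>B. c \<beta> (s \<beta>)) * (\<Sum>k\<in>cfgs N D. (\<Prod>\<beta>\<in>B. X \<beta> (s \<beta>) k) * \<delta> k * \<psi> k))"
    by (subst sum.swap) (simp only: sum_distrib_left)
  finally show ?thesis
    unfolding c_def X_def \<delta>_def tensor_weyl_apply[OF D B j] .
qed

text \<open>The operators \<open>T\<^sub>s\<close> and \<open>H\<^sub>a\<close> of each party act on the state like the powers of a
  clock and of a shift; the gates then perform phase estimation of the clock, followed by the
  undoing of its eigenvalue by the shift.\<close>

lemma phase_gates_extract_ghz:
  assumes D: "D > 0" and q: "q > 0" and B: "finite B" and \<beta>0: "\<beta>0 \<in> B"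
    and T: "\<And>s k. k \<in> cfgs N D \<Longrightarrow> (\<Prod>\<beta>\<in>B. cT \<beta> (s \<beta>)) *
        weyl {..<N} D (lift_label part B (\<lambda>\<beta> i. int (s \<beta>) * tx i)) (lift_label part B (\<lambda>\<beta> i. int (s \<beta>) * tz i)) \<psi> k
      = \<Psi> (\<Sum>\<beta>\<in>B. s \<beta>) k"
    and per: "\<And>s k. k \<in> cfgs N D \<Longrightarrow> \<Psi> (s + q) k = \<Psi> s k"
    and H: "\<And>a s k. k \<in> cfgs N D \<Longrightarrow> (\<Prod>\<beta>\<in>B. cH \<beta> a) *
        weyl {..<N} D (lift_label part B (\<lambda>_ i. int a * hx i)) (lift_label part B (\<lambda>_ i. int a * hz i)) (\<Psi> s) k
      = ph q (2 * (int a * int s)) * \<Psi> s k"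
    and j: "j \<in> cfgs N D" and a: "a \<in> PiE B (\<lambda>_. {..<q})"
  shows "(\<Sum>kb\<in>full_cfgs N D B q.
      local_tensor N part B (\<lambda>\<beta>. phase_gate D q (party N part \<beta>) (cH \<beta>) hx hz (cT \<beta>) tx tz) (j, a) kb
      * with_ancillas B \<psi> kb)
    = (if \<forall>\<beta>\<in>B. a \<beta> = a \<beta>0 then (\<Sum>s<q. \<Psi> s j) / of_nat q else 0)"
    (is "?lhs = _")
proof -
  let ?P = "PiE B (\<lambda>_. {..<q})"
  let ?X = "lift_label part B (\<lambda>\<beta> i. int (a \<beta>) * hx i)"
  let ?Z = "lift_label part B (\<lambda>\<beta> i. int (a \<beta>) * hz i)"
  let ?j = "shift {..<N} D ?X j"
  let ?C = "(\<Prod>\<beta>\<in>B. cH \<beta> (a \<beta>)) * wphase {..<N} D ?X ?Z j"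
  let ?T = "\<lambda>s. weyl {..<N} D (lift_label part B (\<lambda>\<beta> i. int (s \<beta>) * tx i))
    (lift_label part B (\<lambda>\<beta> i. int (s \<beta>) * tz i)) \<psi>"
  have "?lhs = (\<Sum>s\<in>?P. ?C * ((\<Prod>\<beta>\<in>B. ph q (- 2 * (int (s \<beta>) * int (a \<beta>))) / of_nat q) * \<Psi> (\<Sum>\<beta>\<in>B. s \<beta>) ?j))"
    unfolding phase_gates_apply[OF D q B j]
  proof (intro sum.cong refl)
    fix s
    have "\<Psi> (\<Sum>\<beta>\<in>B. s \<beta>) ?j = (\<Prod>\<beta>\<in>B. cT \<beta> (s \<beta>)) * ?T s ?j"
      using D by (simp add: T)
    thus "(\<Prod>\<beta>\<in>B. ph q (- 2 * (int (s \<beta>) * int (a \<beta>))) / of_nat q * (cH \<beta> (a \<beta>) * cT \<beta> (s \<beta>))) *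
        weyl {..<N} D ?X ?Z (?T s) j =
      ?C * ((\<Prod>\<beta>\<in>B. ph q (- 2 * (int (s \<beta>) * int (a \<beta>))) / of_nat q) * \<Psi> (\<Sum>\<beta>\<in>B. s \<beta>) ?j)"
      unfolding weyl_def[of "{..<N}" D ?X ?Z] prod.distrib by (simp only: ac_simps)
  qed
  also have "\<dots> = ?C * (\<Sum>s\<in>?P. (\<Prod>\<beta>\<in>B. ph q (- 2 * (int (s \<beta>) * int (a \<beta>))) / of_nat q) * \<Psi> (\<Sum>\<beta>\<in>B. s \<beta>) ?j)"
    by (simp only: sum_distrib_left)
  also have "(\<Sum>s\<in>?P. (\<Prod>\<beta>\<in>B. ph q (- 2 * (int (s \<beta>) * int (a \<beta>))) / of_nat q) * \<Psi> (\<Sum>\<beta>\<in>B. s \<beta>) ?j)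
    = (if \<forall>\<beta>\<in>B. a \<beta> = a \<beta>0 then (\<Sum>t<q. ph q (- 2 * (int (a \<beta>0) * int t)) * \<Psi> t ?j) / of_nat q else 0)"
    using per D by (intro ghz_fourier[where f = "\<lambda>s. \<Psi> s ?j", OF q _ B a \<beta>0]) simp
  finally have lhs: "?lhs = ?C * \<dots>" .
  show ?thesis
  proof (cases "\<forall>\<beta>\<in>B. a \<beta> = a \<beta>0")
    case True
    have lab: "lift_label part B (\<lambda>\<beta> i. int (a \<beta>) * f i) = lift_label part B (\<lambda>_ i. int (a \<beta>0) * f i)" for f
      using True by (force simp: lift_label_def fun_eq_iff)
    have pr: "(\<Prod>\<beta>\<in>B. cH \<beta> (a \<beta>)) = (\<Prod>\<beta>\<in>B. cH \<beta> (a \<beta>0))"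
      using True by (intro prod.cong refl) metis
    have C: "?C * \<Psi> t ?j = ph q (2 * (int (a \<beta>0) * int t)) * \<Psi> t j" for t
      using H[OF j, of "a \<beta>0" t] unfolding weyl_def pr lab by (simp only: mult.assoc)
    have "?lhs = ?C * ((\<Sum>t<q. ph q (- 2 * (int (a \<beta>0) * int t)) * \<Psi> t ?j) / of_nat q)"
      by (rule lhs[unfolded if_P[OF True]])
    also have "\<dots> = (\<Sum>t<q. ph q (- 2 * (int (a \<beta>0) * int t)) * (?C * \<Psi> t ?j)) / of_nat q"
      by (simp only: times_divide_eq_right sum_distrib_left ac_simps)
    also have "\<dots> = (\<Sum>t<q. \<Psi> t j) / of_nat q"
      unfolding C mult.assoc[symmetric] by simp
    finally show ?thesis using True by argo
  next
    case False
    show ?thesis unfolding lhs if_not_P[OF False] by (rule mult_zero_right)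
  qed
qed

lemma cnj_mult_unimodular: "norm z = 1 \<Longrightarrow> cnj z * z = 1"
  by (simp add: mult.commute[of "cnj z"] complex_norm_square[symmetric])

lemma prod_cis: "(\<Prod>i\<in>A. cis (f i)) = cis (\<Sum>i\<in>A. f i)"
  by (induction A rule: infinite_finite_induct) (simp_all add: cis_mult)

lemma sum_lift_label_symplectic:
  assumes "finite B"
  shows "(\<Sum>i<N. gx i * lift_label part B z i - gz i * lift_label part B x i)
    = (\<Sum>\<beta>\<in>B. \<Sum>i\<in>party N part \<beta>. gx i * z \<beta> i - gz i * x \<beta> i)"
proof -
  have "(\<Sum>i<N. gx i * lift_label part B z i - gz i * lift_label part B x i)
      = (\<Sum>i<N. if part i \<in> B then gx i * z (part i) i - gz i * x (part i) i else 0)"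
    by (intro sum.cong refl) (simp add: lift_label_def)
  also have "\<dots> = (\<Sum>\<beta>\<in>B. \<Sum>i\<in>party N part \<beta>. gx i * z (part i) i - gz i * x (part i) i)"
    by (rule sum_parties[OF assms])
  also have "\<dots> = (\<Sum>\<beta>\<in>B. \<Sum>i\<in>party N part \<beta>. gx i * z \<beta> i - gz i * x \<beta> i)"
    by (intro sum.cong refl) (simp add: party_def)
  finally show ?thesis .
qed

lemma sum_symplectic_combination_right:
  fixes gx gz :: "nat \<Rightarrow> nat \<Rightarrow> int"
  shows "(\<Sum>i\<in>\<alpha>. ax i * (\<Sum>l<K. w l * gz l i) - az i * (\<Sum>l<K. w l * gx l i))
    = (\<Sum>l<K. w l * (\<Sum>i\<in>\<alpha>. ax i * gz l i - az i * gx l i))"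
proof -
  have "(\<Sum>i\<in>\<alpha>. ax i * (\<Sum>l<K. w l * gz l i) - az i * (\<Sum>l<K. w l * gx l i))
      = (\<Sum>i\<in>\<alpha>. \<Sum>l<K. w l * (ax i * gz l i - az i * gx l i))"
    unfolding sum_distrib_left sum_subtractf[symmetric]
    by (intro sum.cong refl) (simp add: algebra_simps)
  also have "\<dots> = (\<Sum>l<K. \<Sum>i\<in>\<alpha>. w l * (ax i * gz l i - az i * gx l i))"
    by (rule sum.swap)
  finally show ?thesis by (simp only: sum_distrib_left)
qed

lemma eq_cong_trans [trans]: "a = b \<Longrightarrow> [b = c] (mod m) \<Longrightarrow> [a = c] (mod m)"
  by simp

lemma cong_eq_trans [trans]: "[a = b] (mod m) \<Longrightarrow> b = c \<Longrightarrow> [a = c] (mod m)"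
  by simp

lemma phase_mat_cong:
  "[\<Sum>i\<in>\<alpha>. gx k i * gz l i - gz k i * gx l i = phase_mat D gx gz \<alpha> k l] (mod int D)"
  by (simp add: phase_mat_def cong_def)

subsection \<open>Extraction of GHZ states\<close>

theorem theorem2:
  fixes p n N m K n' :: nat
    and part :: "nat \<Rightarrow> nat"
    and g\<gamma> :: "nat \<Rightarrow> int" and gx gz :: "nat \<Rightarrow> nat \<Rightarrow> int"
    and S :: "qop set" and \<psi> :: "cfg \<Rightarrow> complex"
    and B :: "nat set" and v :: "nat \<Rightarrow> int"
  assumes prime: "prime p" and n_pos: "n \<ge> 1"
    and parts: "\<forall>i<N. part i \<in> {1..m}"
    and gens_pauli: "\<forall>i<K. pauli_phase_ok (p ^ n) (g\<gamma> i)"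
    and S_def: "S = gen_group N (p ^ n) {pauli N (p ^ n) (g\<gamma> i) (gx i) (gz i) | i. i < K}"
    and S_stab: "stabilizer_group N (p ^ n) S"
    and S_card: "card S = (p ^ n) ^ N"
    and psi: "is_stabilizer_state N (p ^ n) S \<psi>"
    and B_sub: "B \<subseteq> {1..m}" and B_ne: "B \<noteq> {}"
    and n'_range: "1 \<le> n'" "n' \<le> n"
    and v_nz: "\<exists>i<K. \<not> int p dvd v i"
    and v_span: "\<forall>\<beta>\<in>B. in_span (p ^ n) K (phase_mat (p ^ n) gx gz (party N part \<beta>))
                                  (\<lambda>i. int p ^ (n - n') * v i)"
    and v_nspan: "\<not> in_span (p ^ n) K
                     (\<lambda>i j. \<Sum>\<beta>\<in>B. phase_mat (p ^ n) gx gz (party N part \<beta>) i j)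
                     (\<lambda>i. int p ^ (n - 1) * v i)"
  shows "\<exists>U :: nat \<Rightarrow> (cfg \<times> nat) \<Rightarrow> (cfg \<times> nat) \<Rightarrow> complex. \<exists>\<phi> :: cfg \<Rightarrow> complex.
           (\<forall>\<beta>\<in>B. unitary_on (local_cfgs N (p ^ n) part (p ^ n') \<beta>) (U \<beta>)) \<and>
           (\<forall>(j, a) \<in> full_cfgs N (p ^ n) B (p ^ n').
              (\<Sum>kb\<in>full_cfgs N (p ^ n) B (p ^ n').
                  local_tensor N part B U (j, a) kb * with_ancillas B \<psi> kb)
              = \<phi> j * ghz_pow p n' B a)"
proof -
  define D where "D = p ^ n"
  define q where "q = p ^ n'"
  define r where "r = p ^ (n - n')"
  have p0: "p > 0" using prime by (rule prime_gt_0_nat)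
  hence D: "D > 0" and q: "q > 0" and r: "r > 0" by (simp_all add: D_def q_def r_def)
  have Dqr: "D = q * r"
    using n'_range by (simp add: D_def q_def r_def flip: power_add)
  have B: "finite B" using B_sub finite_subset by blast
  obtain \<beta>0 where \<beta>0: "\<beta>0 \<in> B" using B_ne by blast

  have "\<forall>\<beta>\<in>B. \<exists>u :: nat \<Rightarrow> int. \<forall>k<K.
      int r * v k mod int D = (\<Sum>l<K. phase_mat D gx gz (party N part \<beta>) k l * u l) mod int D"
    using v_span unfolding in_span_def D_def r_def of_nat_power .
  from bchoice[OF this] obtain u :: "nat \<Rightarrow> nat \<Rightarrow> int" where "\<forall>\<beta>\<in>B. \<forall>k<K.
      int r * v k mod int D = (\<Sum>l<K. phase_mat D gx gz (party N part \<beta>) k l * u \<beta> l) mod int D"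
    by blast
  hence u: "[\<Sum>l<K. phase_mat D gx gz (party N part \<beta>) k l * u \<beta> l = int r * v k] (mod int D)"
    if "\<beta> \<in> B" "k < K" for \<beta> k
    using that unfolding cong_def by simp
  define tx where "tx i = (\<Sum>l<K. u (part i) l * gx l i)" for i
  define tz where "tz i = (\<Sum>l<K. u (part i) l * gz l i)" for i
  have pair: "[\<Sum>i\<in>party N part \<beta>. gx k i * tz i - gz k i * tx i = int r * v k] (mod int D)"
    if "\<beta> \<in> B" "k < K" for \<beta> k
  proof -
    have "(\<Sum>i\<in>party N part \<beta>. gx k i * tz i - gz k i * tx i)
        = (\<Sum>i\<in>party N part \<beta>. gx k i * (\<Sum>l<K. u \<beta> l * gz l i) - gz k i * (\<Sum>l<K. u \<beta> l * gx l i))"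
      by (intro sum.cong refl) (simp add: tx_def tz_def party_def)
    also have "\<dots> = (\<Sum>l<K. u \<beta> l * (\<Sum>i\<in>party N part \<beta>. gx k i * gz l i - gz k i * gx l i))"
      by (rule sum_symplectic_combination_right)
    also have "[\<dots> = (\<Sum>l<K. u \<beta> l * phase_mat D gx gz (party N part \<beta>) k l)] (mod int D)"
      by (intro cong_sum cong_mult cong_refl phase_mat_cong)
    also have "(\<Sum>l<K. u \<beta> l * phase_mat D gx gz (party N part \<beta>) k l)
        = (\<Sum>l<K. phase_mat D gx gz (party N part \<beta>) k l * u \<beta> l)"
      by (simp only: mult.commute)
    also have "[\<dots> = int r * v k] (mod int D)"
      by (rule u[OF that])
    finally show ?thesis .
  qed

  obtain w :: "nat \<Rightarrow> int" where
    w: "\<And>k. k < K \<Longrightarrow> int D dvd (\<Sum>l<K. w l * (\<Sum>\<beta>\<in>B. phase_mat D gx gz (party N part \<beta>) l k))"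
    and wv: "\<not> int D dvd (\<Sum>l<K. w l * (int p ^ (n - 1) * v l))"
    using separating_functional[OF D v_nspan[folded D_def]] by blast
  define d where "d = (\<Sum>l<K. w l * v l)"
  have "\<not> int p dvd d"
  proof
    assume "int p dvd d"
    hence "int p ^ (n - 1) * int p dvd int p ^ (n - 1) * d" by (rule mult_dvd_mono[OF dvd_refl])
    moreover have "int p ^ (n - 1) * int p = int D"
      using n_pos by (simp add: D_def flip: power_Suc2)
    moreover have "int p ^ (n - 1) * d = (\<Sum>l<K. w l * (int p ^ (n - 1) * v l))"
      by (simp add: d_def sum_distrib_left mult.left_commute)
    ultimately show False using wv by (simp only:)
  qed
  hence "coprime (int p) d"
    using prime by (intro prime_imp_coprime) simp_all
  hence "coprime d (int D)"
    by (simp add: D_def coprime_commute)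
  then obtain c where c: "[d * c = 1] (mod int D)"
    using cong_solve_coprime_int by blast
  define hx where "hx i = (\<Sum>l<K. - c * w l * gx l i)" for i
  define hz where "hz i = (\<Sum>l<K. - c * w l * gz l i)" for i
  have pair_ht: "[\<Sum>i\<in>party N part \<beta>. hz i * tx i - hx i * tz i = int r] (mod int D)"
    if "\<beta> \<in> B" for \<beta>
  proof -
    have "(\<Sum>i\<in>party N part \<beta>. hz i * tx i - hx i * tz i)
        = (\<Sum>i\<in>party N part \<beta>. tx i * (\<Sum>l<K. - c * w l * gz l i) - tz i * (\<Sum>l<K. - c * w l * gx l i))"
      by (simp only: hx_def hz_def mult.commute)
    also have "\<dots> = (\<Sum>l<K. - c * w l * (\<Sum>i\<in>party N part \<beta>. tx i * gz l i - tz i * gx l i))"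
      by (rule sum_symplectic_combination_right)
    also have "\<dots> = (\<Sum>l<K. c * w l * (\<Sum>i\<in>party N part \<beta>. gx l i * tz i - gz l i * tx i))"
      by (simp add: sum_subtractf algebra_simps)
    also have "[\<dots> = (\<Sum>l<K. c * w l * (int r * v l))] (mod int D)"
      using pair[OF that] by (intro cong_sum cong_mult cong_refl) auto
    also have "(\<Sum>l<K. c * w l * (int r * v l)) = int r * (d * c)"
      by (simp add: d_def sum_distrib_left sum_distrib_right algebra_simps)
    also have "[\<dots> = int r * 1] (mod int D)"
      by (intro cong_mult cong_refl c)
    finally show ?thesis by simp
  qed

  define W where "W e = weyl {..<N} D (lift_label part B (\<lambda>\<beta> i. e \<beta> * tx i)) (lift_label part B (\<lambda>\<beta> i. e \<beta> * tz i))"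
    for e :: "nat \<Rightarrow> int"
  define V where "V a = weyl {..<N} D (lift_label part B (\<lambda>_ i. int a * hx i)) (lift_label part B (\<lambda>_ i. int a * hz i))"
    for a :: nat
  have W_W: "W e (W e' f) j = W (\<lambda>\<beta>. e \<beta> + e' \<beta>) f j" for e e' f j
  proof -
    have iso: "(\<Sum>i<N. lift_label part B (\<lambda>\<beta> i. e \<beta> * tz i) i * lift_label part B (\<lambda>\<beta> i. e' \<beta> * tx i) i
        - lift_label part B (\<lambda>\<beta> i. e \<beta> * tx i) i * lift_label part B (\<lambda>\<beta> i. e' \<beta> * tz i) i) = 0"
      by (intro sum.neutral ballI) (simp add: lift_label_def)
    have add: "(\<lambda>i. lift_label part B (\<lambda>\<beta> i. e \<beta> * t i) i + lift_label part B (\<lambda>\<beta> i. e' \<beta> * t i) i)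
        = lift_label part B (\<lambda>\<beta> i. (e \<beta> + e' \<beta>) * t i)" for t
      by (auto simp: lift_label_def algebra_simps)
    show ?thesis
      unfolding W_def weyl_weyl[OF D] iso add by simp
  qed
  have W_cong: "W e f j = W e' f j" if "\<And>\<beta>. \<beta> \<in> B \<Longrightarrow> e \<beta> = e' \<beta>" for e e' f j
  proof -
    have "lift_label part B (\<lambda>\<beta> i. e \<beta> * t i) = lift_label part B (\<lambda>\<beta> i. e' \<beta> * t i)" for t
      using that by (auto simp: lift_label_def)
    thus ?thesis by (simp add: W_def)
  qed
  have W_eigen: "W e f j = z * W e g j" if "\<And>k. k \<in> cfgs N D \<Longrightarrow> f k = z * g k" for e f g z j
    using that D by (simp add: W_def weyl_def)
  have psi': "is_stabilizer_state N D (gen_group N D {pauli N D (g\<gamma> i) (gx i) (gz i) | i. i < K}) \<psi>"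
    using psi unfolding S_def D_def .

  have ex_\<chi>: "\<forall>e. \<exists>z. int q dvd (\<Sum>\<beta>\<in>B. e \<beta>) \<longrightarrow> norm z = 1 \<and> (\<forall>j\<in>cfgs N D. W e \<psi> j = z * \<psi> j)"
    (is "\<forall>e. ?P e")
  proof
    fix e show "?P e"
    proof (cases "int q dvd (\<Sum>\<beta>\<in>B. e \<beta>)")
      case True
      have "int D dvd (\<Sum>i<N. gx k i * lift_label part B (\<lambda>\<beta> i. e \<beta> * tz i) i
          - gz k i * lift_label part B (\<lambda>\<beta> i. e \<beta> * tx i) i)" if k: "k < K" for k
      proof -
        have "(\<Sum>i<N. gx k i * lift_label part B (\<lambda>\<beta> i. e \<beta> * tz i) i
            - gz k i * lift_label part B (\<lambda>\<beta> i. e \<beta> * tx i) i)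
            = (\<Sum>\<beta>\<in>B. e \<beta> * (\<Sum>i\<in>party N part \<beta>. gx k i * tz i - gz k i * tx i))"
          unfolding sum_lift_label_symplectic[OF B] sum_distrib_left
          by (intro sum.cong refl) (simp add: algebra_simps)
        also have "[\<dots> = (\<Sum>\<beta>\<in>B. e \<beta> * (int r * v k))] (mod int D)"
          using pair k by (intro cong_sum cong_mult cong_refl) auto
        also have "(\<Sum>\<beta>\<in>B. e \<beta> * (int r * v k)) = (\<Sum>\<beta>\<in>B. e \<beta>) * int r * v k"
          by (simp add: sum_distrib_right mult.assoc)
        also have "[\<dots> = 0] (mod int D)"
          using True unfolding cong_0_iff Dqr of_nat_mult by (intro dvd_mult2 mult_dvd_mono) auto
        finally show ?thesis by (simp only: cong_0_iff)
      qed
      from stabilizer_state_eigenvector[OF D psi' this] show ?thesis by (auto simp: W_def)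
    qed auto
  qed
  from choice[OF ex_\<chi>] obtain \<chi> where
    \<chi>: "\<And>e. int q dvd (\<Sum>\<beta>\<in>B. e \<beta>) \<Longrightarrow> norm (\<chi> e) = 1"
       "\<And>e j. int q dvd (\<Sum>\<beta>\<in>B. e \<beta>) \<Longrightarrow> j \<in> cfgs N D \<Longrightarrow> W e \<psi> j = \<chi> e * \<psi> j"
    by blast

  have ex_\<eta>: "\<forall>a. \<exists>z. norm z = 1 \<and> (\<forall>j\<in>cfgs N D. V a \<psi> j = z * \<psi> j)"
  proof
    fix a
    have "int D dvd (\<Sum>i<N. gx k i * lift_label part B (\<lambda>_ i. int a * hz i) i
        - gz k i * lift_label part B (\<lambda>_ i. int a * hx i) i)" if k: "k < K" for k
    proof -
      have "(\<Sum>i<N. gx k i * lift_label part B (\<lambda>_ i. int a * hz i) i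
          - gz k i * lift_label part B (\<lambda>_ i. int a * hx i) i)
          = (\<Sum>\<beta>\<in>B. int a * (\<Sum>i\<in>party N part \<beta>. gx k i * hz i - gz k i * hx i))"
        unfolding sum_lift_label_symplectic[OF B] sum_distrib_left
        by (intro sum.cong refl) (simp add: algebra_simps)
      also have "\<dots> = (\<Sum>\<beta>\<in>B. int a * (\<Sum>l<K. - c * w l * (\<Sum>i\<in>party N part \<beta>. gx k i * gz l i - gz k i * gx l i)))"
        unfolding hx_def hz_def sum_symplectic_combination_right ..
      also have "\<dots> = (\<Sum>\<beta>\<in>B. int a * (\<Sum>l<K. c * w l * (\<Sum>i\<in>party N part \<beta>. gx l i * gz k i - gz l i * gx k i)))"
        by (simp add: sum_subtractf algebra_simps)
      also have "[\<dots> = (\<Sum>\<beta>\<in>B. int a * (\<Sum>l<K. c * w l * phase_mat D gx gz (party N part \<beta>) l k))] (mod int D)"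
        by (intro cong_sum cong_mult cong_refl phase_mat_cong)
      also have "(\<Sum>\<beta>\<in>B. int a * (\<Sum>l<K. c * w l * phase_mat D gx gz (party N part \<beta>) l k))
          = int a * c * (\<Sum>l<K. w l * (\<Sum>\<beta>\<in>B. phase_mat D gx gz (party N part \<beta>) l k))"
        unfolding sum_distrib_left by (subst sum.swap) (simp only: ac_simps)
      also have "[\<dots> = 0] (mod int D)"
        unfolding cong_0_iff using w[OF k] by (rule dvd_mult)
      finally show ?thesis by (simp only: cong_0_iff)
    qed
    from stabilizer_state_eigenvector[OF D psi' this] show "\<exists>z. norm z = 1 \<and> (\<forall>j\<in>cfgs N D. V a \<psi> j = z * \<psi> j)" by (simp add: V_def)
  qed
  from choice[OF ex_\<eta>] obtain \<eta> where
    \<eta>: "\<And>a. norm (\<eta> a) = 1" "\<And>a j. j \<in> cfgs N D \<Longrightarrow> V a \<psi> j = \<eta> a * \<psi> j"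
    by blast

  define \<delta> :: "nat \<Rightarrow> nat \<Rightarrow> int" where "\<delta> \<beta> \<gamma> = (if \<gamma> = \<beta> then 1 else 0)" for \<beta> \<gamma>
  have sum_\<delta>: "(\<Sum>\<gamma>\<in>B. \<delta> \<beta> \<gamma>) = 1" if "\<beta> \<in> B" for \<beta>
    using that B by (simp add: \<delta>_def)
  have "norm (\<chi> (\<lambda>\<gamma>. int q * \<delta> \<beta>0 \<gamma>)) = 1"
    by (rule \<chi>) (simp add: sum_\<delta>[OF \<beta>0] flip: sum_distrib_left)
  then obtain \<theta> where \<theta>: "\<chi> (\<lambda>\<gamma>. int q * \<delta> \<beta>0 \<gamma>) = cis \<theta>"
    using rcis_cmod_Arg[of "\<chi> (\<lambda>\<gamma>. int q * \<delta> \<beta>0 \<gamma>)"] by (metis rcis_def mult_1 of_real_1)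
  define \<rho> where "\<rho> s = cis (- \<theta> / real q * real s)" for s :: nat
  have \<rho>_add: "\<rho> (s + t) = \<rho> s * \<rho> t" for s t
    by (simp add: \<rho>_def cis_mult algebra_simps)
  have \<rho>_q: "\<rho> q * cis \<theta> = 1"
    using q by (simp add: \<rho>_def cis_mult)
  define \<Psi> where "\<Psi> s k = \<rho> s * W (\<lambda>\<gamma>. int s * \<delta> \<beta>0 \<gamma>) \<psi> k" for s k
  have per: "\<Psi> (s + q) k = \<Psi> s k" if "k \<in> cfgs N D" for s k
  proof -
    have "W (\<lambda>\<gamma>. int (s + q) * \<delta> \<beta>0 \<gamma>) \<psi> k = W (\<lambda>\<gamma>. int s * \<delta> \<beta>0 \<gamma>) (W (\<lambda>\<gamma>. int q * \<delta> \<beta>0 \<gamma>) \<psi>) k"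
      unfolding W_W by (rule W_cong) (simp add: algebra_simps)
    also have "\<dots> = cis \<theta> * W (\<lambda>\<gamma>. int s * \<delta> \<beta>0 \<gamma>) \<psi> k"
      unfolding \<theta>[symmetric] by (intro W_eigen \<chi>) (simp add: sum_\<delta>[OF \<beta>0] flip: sum_distrib_left)
    finally have "\<Psi> (s + q) k = (\<rho> q * cis \<theta>) * \<Psi> s k"
      unfolding \<Psi>_def \<rho>_add by (simp only: ac_simps)
    thus ?thesis unfolding \<rho>_q by simp
  qed

  define \<epsilon> where "\<epsilon> \<beta> s = (\<lambda>\<gamma>. int s * (\<delta> \<beta> \<gamma> - \<delta> \<beta>0 \<gamma>))" for \<beta> s
  have \<epsilon>: "int q dvd (\<Sum>\<gamma>\<in>B. \<epsilon> \<beta> s \<gamma>)" if "\<beta> \<in> B" for \<beta> s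
    by (simp add: \<epsilon>_def sum_subtractf sum_\<delta> that \<beta>0 flip: sum_distrib_left)
  define cT where "cT \<beta> s = cnj (\<chi> (\<epsilon> \<beta> s)) * \<rho> s" for \<beta> s
  define cH where "cH \<beta> a = (if \<beta> = \<beta>0 then cnj (\<eta> a) else 1)" for \<beta> a
  have norm_cH: "norm (cH \<beta> a) = 1" for \<beta> a
    by (simp add: cH_def \<eta>)
  have norm_cT: "norm (cT \<beta> s) = 1" if "\<beta> \<in> B" for \<beta> s
    by (simp add: cT_def norm_mult \<chi>(1)[OF \<epsilon>[OF that]] \<rho>_def)

  have T: "(\<Prod>\<beta>\<in>B. cT \<beta> (s \<beta>)) * W (\<lambda>\<beta>. int (s \<beta>)) \<psi> k = \<Psi> (\<Sum>\<beta>\<in>B. s \<beta>) k"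
    if k: "k \<in> cfgs N D" for s :: "nat \<Rightarrow> nat" and k
  proof -
    have part_eigen: "W (\<lambda>\<gamma>. \<Sum>\<beta>\<in>F. \<epsilon> \<beta> (s \<beta>) \<gamma>) \<psi> j = (\<Prod>\<beta>\<in>F. \<chi> (\<epsilon> \<beta> (s \<beta>))) * \<psi> j"
      if "finite F" "F \<subseteq> B" "j \<in> cfgs N D" for F j
      using that
    proof (induction F arbitrary: j rule: finite_induct)
      case empty
      have "lift_label part B (\<lambda>_ _. 0) = (\<lambda>_. 0)"
        by (auto simp: lift_label_def)
      thus ?case using empty weyl_0[of j "{..<N}" D \<psi>] by (simp add: W_def cfgs_def)
    next
      case (insert \<beta> F)
      have "W (\<lambda>\<gamma>. \<Sum>\<beta>\<in>insert \<beta> F. \<epsilon> \<beta> (s \<beta>) \<gamma>) \<psi> j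
          = W (\<epsilon> \<beta> (s \<beta>)) (W (\<lambda>\<gamma>. \<Sum>\<beta>\<in>F. \<epsilon> \<beta> (s \<beta>) \<gamma>) \<psi>) j"
        unfolding W_W using insert.hyps by (intro W_cong) simp
      also have "\<dots> = (\<Prod>\<beta>\<in>F. \<chi> (\<epsilon> \<beta> (s \<beta>))) * W (\<epsilon> \<beta> (s \<beta>)) \<psi> j"
        using insert.IH insert.prems by (intro W_eigen) auto
      also have "W (\<epsilon> \<beta> (s \<beta>)) \<psi> j = \<chi> (\<epsilon> \<beta> (s \<beta>)) * \<psi> j"
        using insert.prems by (intro \<chi> \<epsilon>) auto
      finally show ?case using insert.hyps by simp
    qed
    let ?s = "\<Sum>\<beta>\<in>B. s \<beta>" and ?\<chi> = "\<Prod>\<beta>\<in>B. \<chi> (\<epsilon> \<beta> (s \<beta>))"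
    have "(\<Sum>\<beta>\<in>B. \<epsilon> \<beta> (s \<beta>) \<gamma>) = int (s \<gamma>) - int ?s * \<delta> \<beta>0 \<gamma>" if "\<gamma> \<in> B" for \<gamma>
    proof -
      have "(\<Sum>\<beta>\<in>B. int (s \<beta>) * \<delta> \<beta> \<gamma>) = (\<Sum>\<beta>\<in>B. if \<gamma> = \<beta> then int (s \<beta>) else 0)"
        by (intro sum.cong refl) (simp add: \<delta>_def)
      thus ?thesis
        using that B by (simp add: \<epsilon>_def right_diff_distrib sum_subtractf sum_distrib_right)
    qed
    hence "W (\<lambda>\<beta>. int (s \<beta>)) \<psi> k = W (\<lambda>\<gamma>. int ?s * \<delta> \<beta>0 \<gamma>) (W (\<lambda>\<gamma>. \<Sum>\<beta>\<in>B. \<epsilon> \<beta> (s \<beta>) \<gamma>) \<psi>) k"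
      unfolding W_W by (intro W_cong) simp
    also have "\<dots> = ?\<chi> * W (\<lambda>\<gamma>. int ?s * \<delta> \<beta>0 \<gamma>) \<psi> k"
      using part_eigen[OF B] by (intro W_eigen) auto
    finally have W: "W (\<lambda>\<beta>. int (s \<beta>)) \<psi> k = ?\<chi> * W (\<lambda>\<gamma>. int ?s * \<delta> \<beta>0 \<gamma>) \<psi> k" .
    have "(\<Prod>\<beta>\<in>B. \<rho> (s \<beta>)) = \<rho> ?s"
      by (simp add: \<rho>_def prod_cis sum_distrib_left)
    hence cT: "(\<Prod>\<beta>\<in>B. cT \<beta> (s \<beta>)) = cnj ?\<chi> * \<rho> ?s"
      by (simp add: cT_def prod.distrib)
    have \<chi>1: "cnj ?\<chi> * ?\<chi> = 1"
      using \<chi>(1)[OF \<epsilon>] by (intro cnj_mult_unimodular) (simp add: prod_norm[symmetric])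
    have "(\<Prod>\<beta>\<in>B. cT \<beta> (s \<beta>)) * W (\<lambda>\<beta>. int (s \<beta>)) \<psi> k = (cnj ?\<chi> * ?\<chi>) * \<Psi> ?s k"
      unfolding W cT \<Psi>_def by (simp only: ac_simps)
    thus ?thesis unfolding \<chi>1 by simp
  qed

  have H: "(\<Prod>\<beta>\<in>B. cH \<beta> a) * V a (\<Psi> s) k = ph q (2 * (int a * int s)) * \<Psi> s k"
    if k: "k \<in> cfgs N D" for a s k
  proof -
    let ?W = "W (\<lambda>\<gamma>. int s * \<delta> \<beta>0 \<gamma>)"
    let ?f = "\<Sum>i<N. lift_label part B (\<lambda>_ i. int a * hz i) i * lift_label part B (\<lambda>\<beta> i. int s * \<delta> \<beta>0 \<beta> * tx i) i
      - lift_label part B (\<lambda>_ i. int a * hx i) i * lift_label part B (\<lambda>\<beta> i. int s * \<delta> \<beta>0 \<beta> * tz i) i"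
    have "?f = (\<Sum>i<N. if part i \<in> B then int a * int s * \<delta> \<beta>0 (part i) * (hz i * tx i - hx i * tz i) else 0)"
      by (intro sum.cong refl) (simp add: lift_label_def algebra_simps)
    also have "\<dots> = (\<Sum>\<beta>\<in>B. \<Sum>i\<in>party N part \<beta>. int a * int s * \<delta> \<beta>0 (part i) * (hz i * tx i - hx i * tz i))"
      by (rule sum_parties[OF B])
    also have "\<dots> = (\<Sum>\<beta>\<in>B. if \<beta> = \<beta>0 then int a * int s * (\<Sum>i\<in>party N part \<beta>0. hz i * tx i - hx i * tz i) else 0)"
      unfolding sum_distrib_left by (intro sum.cong refl) (auto simp: party_def \<delta>_def)
    also have "\<dots> = int a * int s * (\<Sum>i\<in>party N part \<beta>0. hz i * tx i - hx i * tz i)"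
      using B \<beta>0 by simp
    also have "[\<dots> = int a * int s * int r] (mod int D)"
      by (intro cong_mult cong_refl pair_ht \<beta>0)
    finally have f: "[?f = int a * int s * int r] (mod int D)" .
    have "ph D (2 * ?f) = ph D (2 * (int a * int s * int r))"
      using D f by (rule ph_double_cong)
    also have "\<dots> = ph q (2 * (int a * int s))"
      using ph_rescale[OF r, of q "2 * (int a * int s)"] by (simp add: Dqr ac_simps)
    finally have ph: "ph D (2 * ?f) = ph q (2 * (int a * int s))" .
    have "V a (\<Psi> s) k = \<rho> s * V a (?W \<psi>) k"
      by (simp add: V_def \<Psi>_def weyl_def)
    also have "V a (?W \<psi>) k = ph q (2 * (int a * int s)) * ?W (V a \<psi>) k"
      unfolding V_def W_def ph[symmetric] by (rule weyl_commute[OF D])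
    also have "?W (V a \<psi>) k = \<eta> a * ?W \<psi> k"
      by (intro W_eigen \<eta>)
    finally have V: "V a (\<Psi> s) k = \<eta> a * (ph q (2 * (int a * int s)) * \<Psi> s k)"
      unfolding \<Psi>_def by (simp only: ac_simps)
    have "(\<Prod>\<beta>\<in>B. cH \<beta> a) = cnj (\<eta> a)"
      using B \<beta>0 by (simp add: cH_def)
    moreover have "cnj (\<eta> a) * \<eta> a = 1"
      by (intro cnj_mult_unimodular \<eta>)
    ultimately show ?thesis
      unfolding V by (simp only: mult.assoc[symmetric] mult_1)
  qed

  define U where "U \<beta> = phase_gate D q (party N part \<beta>) (cH \<beta>) hx hz (cT \<beta>) tx tz" for \<beta>
  define \<phi> where "\<phi> j = complex_of_real (sqrt (real q)) * ((\<Sum>s<q. \<Psi> s j) / of_nat q)" for j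
  show ?thesis
  proof (intro exI[of _ U] exI[of _ \<phi>] conjI ballI, unfold D_def[symmetric] q_def[symmetric])
    fix \<beta> assume "\<beta> \<in> B"
    thus "unitary_on (local_cfgs N D part q \<beta>) (U \<beta>)"
      unfolding local_cfgs_def U_def using D q norm_cH norm_cT
      by (intro unitary_phase_gate) auto
  next
    fix x assume "x \<in> full_cfgs N D B q"
    then obtain j a where x: "x = (j, a)" and j: "j \<in> cfgs N D" and a: "a \<in> PiE B (\<lambda>_. {..<q})"
      by (auto simp: full_cfgs_def)
    have "(\<Sum>kb\<in>full_cfgs N D B q. local_tensor N part B U (j, a) kb * with_ancillas B \<psi> kb)
        = (if \<forall>\<beta>\<in>B. a \<beta> = a \<beta>0 then (\<Sum>s<q. \<Psi> s j) / of_nat q else 0)"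
      unfolding U_def
      using D q B \<beta>0 T[unfolded W_def] per H[unfolded V_def] j a by (rule phase_gates_extract_ghz)
    also have "\<dots> = \<phi> j * ghz_pow p n' B a"
      using q by (simp add: \<phi>_def ghz_pow_eq[OF p0 a[unfolded q_def] \<beta>0] q_def[symmetric])
    finally show "case x of (j, a) \<Rightarrow>
        (\<Sum>kb\<in>full_cfgs N D B q. local_tensor N part B U (j, a) kb * with_ancillas B \<psi> kb)
        = \<phi> j * ghz_pow p n' B a"
      by (simp add: x)
  qed
qed

end
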